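(* Let $\Gamma\subset\mathbb R^N$ be a network with Hamiltonians $H_\gamma$ and a flux limiter $(c_x)_{x\in\mathbf V}$ as in the context, and let $L$ be the associated overall Lagrangian. Let $\xi$ be an absolutely continuous curve defined in $[a,b]$ and let $x\in\mathbf V$. Assume that $\xi(a)=\xi(b)$, that $\xi([a,b])\subset\gamma([0,1])$ for some $\gamma\in\Gamma_x$, and that $\xi([a,b])\cap(\mathbf V\setminus\{x\})=\emptyset$. Then $$\int_a^bL(\xi,\dot\xi)\,d\tau\ge c_x\,(b-a).$$
   Context: Network. $\mathcal E$ is a finite collection of simple curves $\gamma:[0,1]\to\mathbb R^N$, called arcs, each $C^1$ up to the endpoints with nowhere vanishing derivative, and $\Gamma=\bigcup_{\gamma\in\mathcal E}\gamma([0,1])$. For each arc $\gamma$ the inverse arc $\widetilde\gamma(s)=\gamma(1-s)$ is also regarded as an arc. It is assumed that $\gamma((0,1))\cap\gamma'([0,1])=\emptyset$ whenever $\gamma\ne\gamma'$ and $\gamma\neq\widetilde{\gamma'}$. The set $\mathbf V$ of vertices is the set of initial and terminal points of arcs. $\Gamma$ is connected (any two vertices are linked by a finite concatenation of arcs) and there are no loops ($\gamma(0)\ne\gamma(1)$ for every arc). For $x\in\mathbf V$, $\Gamma_x=\{\gamma \text{ arc}: \gamma(1)=x\}$. The tangent bundle $T\Gamma$ is the set of $(x,q)\in\Gamma\times\mathbb R^N$ such that $q=\lambda\dot\gamma(s)$ for some arc $\gamma$, $s\in[0,1]$ with $x=\gamma(s)$, and $\lambda\in\mathbb R$. Hamiltonians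 and Lagrangians. For each arc $\gamma$, $H_\gamma:[0,1]\times\mathbb R\to\mathbb R$ is continuous, convex in the second variable $\mu$, satisfies $\lim_{|\mu|\to\infty}\inf_{s\in[0,1]}H_\gamma(s,\mu)/|\mu|=+\infty$, and $H_{\widetilde\gamma}(s,\mu)=H_\gamma(1-s,-\mu)$. Set $L_\gamma(s,\lambda)=\max_{\mu\in\mathbb R}(\lambda\mu-H_\gamma(s,\mu))$ and $c_\gamma=-\max_{s\in[0,1]}\min_{\mu\in\mathbb R}H_\gamma(s,\mu)=\min_{s\in[0,1]}L_\gamma(s,0)$. A flux limiter is a function $x\mapsto c_x$ from $\mathbf V$ to $\mathbb R$ with $c_x\le\min_{\gamma\in\Gamma_x}c_\gamma$ for every $x\in\mathbf V$. Overall Lagrangian. $L:T\Gamma\to\mathbb R$ is defined by: if $x\in\gamma((0,1))$, $L(x,q)=L_\gamma\big(\gamma^{-1}(x),\tfrac{q\cdot\dot\gamma(\gamma^{-1}(x))}{|\dot\gamma(\gamma^{-1}(x))|^2}\big)$; if $x\in\mathbf V$, $q\ne0$, $L(x,q)=\min L_\gamma\big(1,\tfrac{q\cdot\dot\gamma(1)}{|\dot\gamma(1)|^2}\big)$, the minimum being over those $\gamma\in\Gamma_x$ with $\dot\gamma(1)$ parallel to $q$; if $x\in\mathbf V$, $L(x,0)=c_x$. It is extended by $L=+\infty$ to $(\mathbb R^N\times\mathbb R^N)\setminus T\Gamma$. *)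

theory Defs
  imports "HOL-Analysis.Analysis"
begin

section \<open>Networks\<close>

text \<open>
  A curve on the unit interval is represented by an element of
  \<^term>\<open>extensional {0..1}\<close>, so that equality of arcs is equality as functions on the unit
  interval and arcs can be used as indices of the Hamiltonians. One-sided
  derivatives are taken at the endpoints.
\<close>

type_synonym 'n curve = "real \<Rightarrow> real ^ 'n"

definition inverse_arc :: "('n::finite) curve \<Rightarrow> 'n curve" where
  "inverse_arc \<gamma> = restrict (reversepath \<gamma>) {0..1}"

definition velocity :: "('n::finite) curve \<Rightarrow> real \<Rightarrow> real ^ 'n" where
  "velocity \<gamma> s = vector_derivative \<gamma> (at s within {0..1})"

definition regular_curve :: "('n::finite) curve \<Rightarrow> bool" where
  "regular_curve \<gamma> \<longleftrightarrow>
     \<gamma> \<in> extensional {0..1} \<and> simple_path \<gamma> \<and>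
     \<gamma> differentiable_on {0..1} \<and> continuous_on {0..1} (velocity \<gamma>) \<and>
     (\<forall>s\<in>{0..1}. velocity \<gamma> s \<noteq> 0)"

definition arcs :: "('n::finite) curve set \<Rightarrow> 'n curve set" where
  "arcs E = E \<union> inverse_arc ` E"

definition vertices :: "('n::finite) curve set \<Rightarrow> (real ^ 'n) set" where
  "vertices E = (\<Union>\<gamma>\<in>arcs E. {\<gamma> 0, \<gamma> 1})"

definition arcs_into :: "('n::finite) curve set \<Rightarrow> real ^ 'n \<Rightarrow> 'n curve set" where
  "arcs_into E x = {\<gamma> \<in> arcs E. \<gamma> 1 = x}"

definition network_set :: "('n::finite) curve set \<Rightarrow> (real ^ 'n) set" where
  "network_set E = (\<Union>\<gamma>\<in>E. \<gamma> ` {0..1})"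

definition network :: "('n::finite) curve set \<Rightarrow> bool" where
  "network E \<longleftrightarrow>
     finite E \<and>
     (\<forall>\<gamma>\<in>E. regular_curve \<gamma>) \<and>
     (\<forall>\<gamma>\<in>arcs E. \<forall>\<gamma>'\<in>arcs E. \<gamma> \<noteq> \<gamma>' \<and> \<gamma> \<noteq> inverse_arc \<gamma>' \<longrightarrow>
        \<gamma> ` {0<..<1} \<inter> \<gamma>' ` {0..1} = {}) \<and>
     (\<forall>x\<in>vertices E. \<forall>y\<in>vertices E. (x, y) \<in> {(\<gamma> 0, \<gamma> 1) | \<gamma>. \<gamma> \<in> arcs E}\<^sup>*) \<and>
     (\<forall>\<gamma>\<in>arcs E. \<gamma> 0 \<noteq> \<gamma> 1)"

definition tangent_bundle :: "('n::finite) curve set \<Rightarrow> ((real ^ 'n) \<times> (real ^ 'n)) set" where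
  "tangent_bundle E =
     {(x, q). x \<in> network_set E \<and>
        (\<exists>\<gamma>\<in>arcs E. \<exists>s\<in>{0..1}. \<exists>r. x = \<gamma> s \<and> q = r *\<^sub>R velocity \<gamma> s)}"


section \<open>Hamiltonians, Lagrangians and flux limiters\<close>

definition hamiltonians ::
  "('n::finite) curve set \<Rightarrow> ('n curve \<Rightarrow> real \<Rightarrow> real \<Rightarrow> real) \<Rightarrow> bool" where
  "hamiltonians E H \<longleftrightarrow>
     (\<forall>\<gamma>\<in>arcs E.
        continuous_on ({0..1} \<times> UNIV) (\<lambda>(s, \<mu>). H \<gamma> s \<mu>) \<and>
        (\<forall>s\<in>{0..1}. convex_on UNIV (H \<gamma> s)) \<and>
        filterlim (\<lambda>\<mu>. INF s\<in>{0..1}. H \<gamma> s \<mu> / \<bar>\<mu>\<bar>) at_top at_infinity \<and>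
        (\<forall>s\<in>{0..1}. \<forall>\<mu>. H (inverse_arc \<gamma>) s \<mu> = H \<gamma> (1 - s) (- \<mu>)))"

text \<open>
  For a family satisfying \<^const>\<open>hamiltonians\<close>, the suprema and infima in the next two
  definitions are attained, i.e. they are the maxima and minima of the theory.
\<close>

definition arc_lagrangian ::
  "(('n::finite) curve \<Rightarrow> real \<Rightarrow> real \<Rightarrow> real) \<Rightarrow> 'n curve \<Rightarrow> real \<Rightarrow> real \<Rightarrow> real" where
  "arc_lagrangian H \<gamma> s r = (SUP \<mu>. r * \<mu> - H \<gamma> s \<mu>)"

definition arc_bound ::
  "(('n::finite) curve \<Rightarrow> real \<Rightarrow> real \<Rightarrow> real) \<Rightarrow> 'n curve \<Rightarrow> real" where
  "arc_bound H \<gamma> = - (SUP s\<in>{0..1}. INF \<mu>. H \<gamma> s \<mu>)"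

definition flux_limiter ::
  "('n::finite) curve set \<Rightarrow> ('n curve \<Rightarrow> real \<Rightarrow> real \<Rightarrow> real) \<Rightarrow> (real ^ 'n \<Rightarrow> real) \<Rightarrow> bool" where
  "flux_limiter E H c \<longleftrightarrow>
     (\<forall>x\<in>vertices E. c x \<le> (MIN \<gamma>\<in>arcs_into E x. arc_bound H \<gamma>))"

text \<open>
  At an interior point of an arc, that arc is unique up to inversion; the value below is the
  same for an arc and its inverse, so the choice made by \<open>SOME\<close> is immaterial.
\<close>

definition overall_lagrangian ::
  "('n::finite) curve set \<Rightarrow> ('n curve \<Rightarrow> real \<Rightarrow> real \<Rightarrow> real) \<Rightarrow> (real ^ 'n \<Rightarrow> real) \<Rightarrow>
   real ^ 'n \<Rightarrow> real ^ 'n \<Rightarrow> ereal" where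
  "overall_lagrangian E H c x q =
     (if (x, q) \<notin> tangent_bundle E then \<infinity>
      else if x \<in> vertices E then
        (if q = 0 then ereal (c x)
         else ereal (MIN \<gamma>\<in>{\<gamma> \<in> arcs_into E x. \<exists>r. q = r *\<^sub>R velocity \<gamma> 1}.
                arc_lagrangian H \<gamma> 1 ((q \<bullet> velocity \<gamma> 1) / (norm (velocity \<gamma> 1))\<^sup>2)))
      else
        (let \<gamma> = (SOME \<gamma>. \<gamma> \<in> arcs E \<and> x \<in> \<gamma> ` {0<..<1});
             s = inv_into {0..1} \<gamma> x
         in ereal (arc_lagrangian H \<gamma> s ((q \<bullet> velocity \<gamma> s) / (norm (velocity \<gamma> s))\<^sup>2))))"


section \<open>Absolutely continuous curves and extended-valued integrals\<close>

definition absolutely_continuous_curve ::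
  "real \<Rightarrow> real \<Rightarrow> (real \<Rightarrow> 'a::real_normed_vector) \<Rightarrow> bool" where
  "absolutely_continuous_curve a b \<xi> \<longleftrightarrow>
     (\<forall>\<epsilon>>0. \<exists>\<delta>>0. \<forall>(n::nat) u v.
        (\<forall>i<n. a \<le> u i \<and> u i \<le> v i \<and> v i \<le> b) \<and>
        (\<forall>i<n. \<forall>j<n. i \<noteq> j \<longrightarrow> {u i<..<v i} \<inter> {u j<..<v j} = {}) \<and>
        (\<Sum>i<n. v i - u i) < \<delta> \<longrightarrow>
        (\<Sum>i<n. norm (\<xi> (v i) - \<xi> (u i))) < \<epsilon>)"

text \<open>
  The integral of an extended real function, with \<open>+\<infinity>\<close> as an admissible value. Note that
  \<^const>\<open>e2ennreal\<close> truncates at 0, so that the two integrals are those of the positive and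
  negative parts. The default value \<open>-\<infinity>\<close> ensures that a lower bound by a real number also
  asserts that the integral is well defined.
\<close>

definition extended_integral :: "'a measure \<Rightarrow> ('a \<Rightarrow> ereal) \<Rightarrow> ereal" where
  "extended_integral M f =
     (if f \<in> borel_measurable M \<and> (\<integral>\<^sup>+ t. e2ennreal (- f t) \<partial>M) < \<infinity>
      then enn2ereal (\<integral>\<^sup>+ t. e2ennreal (f t) \<partial>M) - enn2ereal (\<integral>\<^sup>+ t. e2ennreal (- f t) \<partial>M)
      else - \<infinity>)"

end

theory Submission
  imports Defs
begin

text \<open>
  Fix \<open>\<gamma>\<close> with \<open>\<xi> = \<gamma> \<circ> s\<close>. Since \<open>\<gamma>\<close> is bi-Lipschitz, \<open>s\<close> is absolutely continuous, hence
  differentiable almost everywhere. Where \<open>s = 1\<close> the curve sits at \<open>x\<close> and \<open>s\<close> is maximal, so its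
  derivative vanishes and the Lagrangian equals \<open>c x\<close>. Where \<open>s < 1\<close> the Lagrangian is at least
  \<open>p(s) s' - H(s, p(s))\<close> for any function \<open>p\<close>; choosing \<open>p\<close> continuous with
  \<open>H(s, p(s)) \<le> \<epsilon> - c x\<close>, which is possible because \<open>c x\<close> is at most the arc bound, gives the
  lower bound \<open>p(s) s' + c x - \<epsilon>\<close>. The first term is the derivative of \<open>P \<circ> s\<close> for a primitive \<open>P\<close>
  of \<open>p\<close>, so its integral over the closed curve is zero. This last step uses the gauge integral, for which
  the fundamental theorem of calculus holds without knowing that the derivative is absolutely integrable.
\<close>

section \<open>Absolutely continuous functions of one variable\<close>

text \<open>The parameter \<open>s\<close> may equal 1 on a nowhere dense set of positive measure.
  Rather than cutting the curve into excursions away from \<open>x\<close>, the inequality is proved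
  pointwise on all of \<open>[a, b]\<close> and integrated once. The slack \<epsilon> is the price
  of continuity of \<open>p\<close>: an exact minimiser of the Hamiltonian need not depend
  continuously on the parameter. Continuity makes the primitive \<open>P\<close> differentiable at
  every parameter; differentiability almost everywhere would not do, because \<open>s\<close> may
  spend positive time in a null set. The two notions of integral meet at one point only. The
  Lagrangian along the curve is measurable and bounded below, so its Lebesgue integral is either
  infinite, with nothing left to prove, or finite; in the latter case it is also a gauge integral
  and can be compared with that of the lower bound. Almost everywhere differentiability is obtained
  directly from Vitali coverings, without a detour through functions of bounded variation.\<close>

definition nonoverlapping :: "'i set \<Rightarrow> ('i \<Rightarrow> real) \<Rightarrow> ('i \<Rightarrow> real) \<Rightarrow> bool" where
  "nonoverlapping I u v \<longleftrightarrow>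
     finite I \<and> (\<forall>i\<in>I. u i \<le> v i) \<and>
     (\<forall>i\<in>I. \<forall>j\<in>I. i \<noteq> j \<longrightarrow> {u i<..<v i} \<inter> {u j<..<v j} = {})"

lemma nonoverlapping_finite: "nonoverlapping I u v \<Longrightarrow> finite I"
  by (simp add: nonoverlapping_def)

lemma nonoverlapping_subset: "nonoverlapping I u v \<Longrightarrow> J \<subseteq> I \<Longrightarrow> nonoverlapping J u v"
  unfolding nonoverlapping_def by (meson finite_subset subsetD)

lemma nonoverlapping_sum_le_measure:
  assumes no: "nonoverlapping I u v" and U: "U \<in> lmeasurable"
    and sub: "\<And>i. i \<in> I \<Longrightarrow> {u i<..<v i} \<subseteq> U"
  shows "(\<Sum>i\<in>I. v i - u i) \<le> measure lebesgue U"
proof -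
  have fin: "finite I" and le: "\<And>i. i \<in> I \<Longrightarrow> u i \<le> v i"
    using no by (auto simp: nonoverlapping_def)
  have "(\<Sum>i\<in>I. v i - u i) = (\<Sum>i\<in>I. measure lebesgue {u i<..<v i})"
    by (intro sum.cong refl) (simp add: le)
  also have "\<dots> = measure lebesgue (\<Union>i\<in>I. {u i<..<v i})"
  proof (rule measure_UNION'[symmetric])
    show "pairwise (\<lambda>i j. disjnt {u i<..<v i} {u j<..<v j}) I"
      using no by (auto simp: nonoverlapping_def pairwise_def disjnt_def)
  qed (use fin in auto)
  also have "\<dots> \<le> measure lebesgue U"
    using sub U by (intro measure_mono_fmeasurable) (auto intro!: sets.finite_UN fin)
  finally show ?thesis .
qed

text \<open>The definition numbers its intervals by naturals. Enumerating the index set by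
  \<open>h\<close> admits any index type: tagged pairs of a division, pairs of endpoints from a
  Vitali family, or gaps labelled by the interval that contains them.\<close>

lemma absolutely_continuous_curveE:
  assumes ac: "absolutely_continuous_curve a b f" and "\<epsilon> > 0"
  obtains \<delta> where "\<delta> > 0"
    "\<forall>(I::'i set) u v. nonoverlapping I u v \<and> (\<forall>i\<in>I. a \<le> u i \<and> v i \<le> b) \<and>
       (\<Sum>i\<in>I. v i - u i) < \<delta> \<longrightarrow> (\<Sum>i\<in>I. norm (f (v i) - f (u i))) < \<epsilon>"
proof -
  obtain \<delta> where "\<delta> > 0" and \<delta>: "\<forall>(n::nat) u v.
        (\<forall>i<n. a \<le> u i \<and> u i \<le> v i \<and> v i \<le> b) \<and>
        (\<forall>i<n. \<forall>j<n. i \<noteq> j \<longrightarrow> {u i<..<v i} \<inter> {u j<..<v j} = {}) \<and>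
        (\<Sum>i<n. v i - u i) < \<delta> \<longrightarrow>
        (\<Sum>i<n. norm (f (v i) - f (u i))) < \<epsilon>"
    using ac[unfolded absolutely_continuous_curve_def, THEN spec, THEN mp, OF \<open>\<epsilon> > 0\<close>] by blast
  have "(\<Sum>i\<in>I. norm (f (v i) - f (u i))) < \<epsilon>"
    if no: "nonoverlapping I u v" and ab: "\<And>i. i \<in> I \<Longrightarrow> a \<le> u i \<and> v i \<le> b"
      and less: "(\<Sum>i\<in>I. v i - u i) < \<delta>" for I :: "'i set" and u v
  proof -
    have "finite I" using no by (rule nonoverlapping_finite)
    then obtain h where h: "bij_betw h {..<card I} I"
      using ex_bij_betw_nat_finite[of I] by (auto simp: atLeast0LessThan)
    have hI: "h i \<in> I" if "i < card I" for i
      using h that by (auto simp: bij_betw_def)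
    have hne: "h i \<noteq> h j" if "i < card I" "j < card I" "i \<noteq> j" for i j
      using h that by (auto simp: bij_betw_def inj_on_def)
    have "(\<Sum>i<card I. norm (f ((v \<circ> h) i) - f ((u \<circ> h) i))) < \<epsilon>"
    proof (rule \<delta>[THEN spec, THEN spec, THEN spec, THEN mp], intro conjI)
      show "(\<Sum>i<card I. (v \<circ> h) i - (u \<circ> h) i) < \<delta>"
        using less sum.reindex_bij_betw[OF h, of "\<lambda>i. v i - u i"] by simp
    qed (use no hI hne ab in \<open>auto simp: nonoverlapping_def\<close>)
    then show ?thesis
      using sum.reindex_bij_betw[OF h, of "\<lambda>i. norm (f (v i) - f (u i))"] by simp
  qed
  with \<open>\<delta> > 0\<close> that show ?thesis by blast
qed

lemma absolutely_continuous_curve_imp_continuous_on: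
  assumes ac: "absolutely_continuous_curve a b f"
  shows "continuous_on {a..b} f"
  unfolding continuous_on_iff
proof (intro ballI allI impI)
  fix x and e :: real assume x: "x \<in> {a..b}" and "e > 0"
  obtain d where "d > 0" and d: "\<forall>(I::unit set) u v. nonoverlapping I u v \<and>
      (\<forall>i\<in>I. a \<le> u i \<and> v i \<le> b) \<and>
      (\<Sum>i\<in>I. v i - u i) < d \<longrightarrow> (\<Sum>i\<in>I. norm (f (v i) - f (u i))) < e"
    using absolutely_continuous_curveE[OF ac \<open>e > 0\<close>] by blast
  have "dist (f y) (f x) < e" if y: "y \<in> {a..b}" "dist y x < d" for y
  proof -
    have "norm (f (max x y) - f (min x y)) < e"
      using d[THEN spec[of _ "{()}"], THEN spec[of _ "\<lambda>_. min x y"], THEN spec[of _ "\<lambda>_. max x y"]] x y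
      by (auto simp: nonoverlapping_def dist_real_def)
    then show ?thesis
      by (auto simp: dist_norm min_def max_def norm_minus_commute split: if_splits)
  qed
  with \<open>d > 0\<close> show "\<exists>d>0. \<forall>x'\<in>{a..b}. dist x' x < d \<longrightarrow> dist (f x') (f x) < e"
    by blast
qed

text \<open>Comparing increments, instead of composing functions, lets one lemma serve the inverse
  of an arc, a primitive evaluated along \<open>s\<close>, and the negative of a function.\<close>

lemma absolutely_continuous_curve_Lipschitz_compose:
  assumes ac: "absolutely_continuous_curve a b f" and "K \<ge> 0"
    and lip: "\<And>s t. s \<in> {a..b} \<Longrightarrow> t \<in> {a..b} \<Longrightarrow> norm (g s - g t) \<le> K * norm (f s - f t)"
  shows "absolutely_continuous_curve a b g"
  unfolding absolutely_continuous_curve_def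
proof (intro allI impI)
  fix e :: real assume "e > 0"
  \<comment> \<open>\<open>K + 1\<close> in place of \<open>K\<close> avoids a division by zero for
    \<open>K = 0\<close>.\<close>
  then have "e / (K + 1) > 0"
    using \<open>K \<ge> 0\<close> by simp
  then obtain d where "d > 0" and d: "\<forall>(n::nat) u v.
        (\<forall>i<n. a \<le> u i \<and> u i \<le> v i \<and> v i \<le> b) \<and>
        (\<forall>i<n. \<forall>j<n. i \<noteq> j \<longrightarrow> {u i<..<v i} \<inter> {u j<..<v j} = {}) \<and>
        (\<Sum>i<n. v i - u i) < d \<longrightarrow>
        (\<Sum>i<n. norm (f (v i) - f (u i))) < e / (K + 1)"
    using ac[unfolded absolutely_continuous_curve_def, THEN spec, THEN mp, OF \<open>e / (K + 1) > 0\<close>] by blast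
  have "(\<Sum>i<n. norm (g (v i) - g (u i))) < e"
    if A: "(\<forall>i<n. a \<le> u i \<and> u i \<le> v i \<and> v i \<le> b) \<and>
        (\<forall>i<n. \<forall>j<n. i \<noteq> j \<longrightarrow> {u i<..<v i} \<inter> {u j<..<v j} = {}) \<and>
        (\<Sum>i<n. v i - u i) < d" for n :: nat and u v
  proof -
    have "(\<Sum>i<n. norm (g (v i) - g (u i))) \<le> (\<Sum>i<n. K * norm (f (v i) - f (u i)))"
      by (intro sum_mono lip) (use A in force)+
    also have "\<dots> \<le> (K + 1) * (\<Sum>i<n. norm (f (v i) - f (u i)))"
      by (simp add: sum_distrib_left[symmetric] distrib_right sum_nonneg)
    also have "\<dots> < e"
      using d[THEN spec, THEN spec, THEN spec, THEN mp, OF A] \<open>K \<ge> 0\<close> by (simp add: field_simps)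
    finally show ?thesis .
  qed
  with \<open>d > 0\<close> show "\<exists>\<delta>>0. \<forall>(n::nat) u v.
        (\<forall>i<n. a \<le> u i \<and> u i \<le> v i \<and> v i \<le> b) \<and>
        (\<forall>i<n. \<forall>j<n. i \<noteq> j \<longrightarrow> {u i<..<v i} \<inter> {u j<..<v j} = {}) \<and>
        (\<Sum>i<n. v i - u i) < \<delta> \<longrightarrow> (\<Sum>i<n. norm (g (v i) - g (u i))) < e"
    by blast
qed

text \<open>A Riemann sum has two kinds of tags. Off \<open>N\<close> the derivative controls the
  error by a small multiple of the length. On \<open>N\<close> the gauge confines the intervals to
  an open set of small measure, where absolute continuity makes the increments sum to little.
  Integrability of \<open>f'\<close> is thus a conclusion.\<close>

theorem fundamental_theorem_of_calculus_absolutely_continuous: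
  fixes f :: "real \<Rightarrow> 'a::banach"
  assumes ac: "absolutely_continuous_curve a b f" and "a \<le> b" and N: "negligible N"
    and deriv: "\<And>x. x \<in> {a..b} - N \<Longrightarrow> (f has_vector_derivative f' x) (at x within {a..b})"
  shows "(f' has_integral (f b - f a)) {a..b}"
proof -
  \<comment> \<open>With value 0 on \<open>N\<close>, a tag there contributes nothing except its
    increment of \<open>f\<close>.\<close>
  define g where "g x = (if x \<in> N then 0 else f' x)" for x
  have "(g has_integral (f b - f a)) {a..b}"
    unfolding has_integral_real
  proof (intro allI impI)
    fix e :: real assume "e > 0"
    define e' where "e' = e / (2 * (b - a + 1))"
    have "e' > 0" using \<open>e > 0\<close> \<open>a \<le> b\<close> by (simp add: e'_def)
    have e': "e' * (b - a) < e / 2"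
      using \<open>e > 0\<close> \<open>a \<le> b\<close> by (simp add: e'_def field_simps)
    have "\<forall>x. \<exists>d>0. x \<in> {a..b} - N \<longrightarrow>
         (\<forall>y\<in>{a..b}. norm (y-x) < d \<longrightarrow> norm (f y - f x - (y-x) *\<^sub>R f' x) \<le> e' * norm (y-x))"
      using deriv[unfolded has_vector_derivative_def has_derivative_within_alt] \<open>e' > 0\<close>
      by (metis zero_less_one)
    then obtain d where d: "\<And>x. 0 < d x"
       "\<And>x y. \<lbrakk>x \<in> {a..b}; x \<notin> N; y \<in> {a..b}; norm (y-x) < d x\<rbrakk>
          \<Longrightarrow> norm (f y - f x - (y-x) *\<^sub>R f' x) \<le> e' * norm (y-x)"
      by (metis DiffI)
    obtain \<delta> where "\<delta> > 0" and \<delta>: "\<forall>(I::(real \<times> real set) set) u v. nonoverlapping I u v \<and>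
        (\<forall>i\<in>I. a \<le> u i \<and> v i \<le> b) \<and>
        (\<Sum>i\<in>I. v i - u i) < \<delta> \<longrightarrow> (\<Sum>i\<in>I. norm (f (v i) - f (u i))) < e / 2"
      using absolutely_continuous_curveE[OF ac half_gt_zero[OF \<open>e > 0\<close>]] by blast
    \<comment> \<open>Outer regularity bounds the measure of \<open>U - N\<close>; as
      \<open>N\<close> is null, this bounds \<open>U\<close> itself.\<close>
    obtain U where U: "open U" "N \<subseteq> U" "U - N \<in> lmeasurable" "emeasure lebesgue (U - N) < ennreal \<delta>"
      using sets_lebesgue_outer_open[of N \<delta>] N \<open>\<delta> > 0\<close> by (metis negligible_imp_sets)
    have Um: "U \<in> lmeasurable"
      using U(3) N by (metis Diff_partition U(2) Un_commute fmeasurable.Un negligible_imp_measurable)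
    have "emeasure lebesgue U = emeasure lebesgue (U - N)"
      using N Um by (intro emeasure_Diff_null_set[symmetric])
        (auto simp: negligible_iff_null_sets)
    then have "ennreal (measure lebesgue U) < ennreal \<delta>"
      using U(4) Um by (simp add: emeasure_eq_measure2)
    then have U\<delta>: "measure lebesgue U < \<delta>"
      by (simp add: ennreal_less_iff)
    define \<gamma> where "\<gamma> x = (if x \<in> N then U else ball x (d x))" for x
    have "gauge \<gamma>"
      using U d(1) by (auto simp: gauge_def \<gamma>_def)
    moreover have "norm ((\<Sum>(x,K)\<in>p. measure lborel K *\<^sub>R g x) - (f b - f a)) < e"
      if p: "p tagged_division_of {a..b}" and fine: "\<gamma> fine p" for p
    proof -
      have fin: "finite p" using p by (rule tagged_division_of_finite)
      have K: "\<exists>u v. K = {u..v} \<and> u \<le> v \<and> x \<in> K \<and> u \<in> {a..b} \<and> v \<in> {a..b}"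
        if xK: "(x, K) \<in> p" for x K
      proof -
        obtain u v where uv: "K = cbox u v" using tagged_division_ofD(4)[OF p xK] by blast
        moreover have "x \<in> K" "K \<subseteq> {a..b}"
          using tagged_division_ofD(2,3)[OF p xK] by auto
        ultimately show ?thesis by (intro exI[of _ u] exI[of _ v]) auto
      qed
      have ba: "b - a = (\<Sum>(x,K)\<in>p. Sup K - Inf K)" "f b - f a = (\<Sum>(x,K)\<in>p. f(Sup K) - f(Inf K))"
        using additive_tagged_division_1[OF \<open>a \<le> b\<close> p, where f= "\<lambda>x. x"]
              additive_tagged_division_1[OF \<open>a \<le> b\<close> p, where f= f] by auto
      define q where "q = {z\<in>p. fst z \<in> N}"
      define r where "r = {z\<in>p. fst z \<notin> N}"
      have pqr: "p = q \<union> r" "q \<inter> r = {}" "finite q" "finite r"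
        using fin by (auto simp: q_def r_def)
      define \<Delta> where "\<Delta> z = (case z of (x,K) \<Rightarrow> measure lborel K *\<^sub>R g x - (f(Sup K) - f(Inf K)))" for z
      have "(\<Sum>(x,K)\<in>p. measure lborel K *\<^sub>R g x) - (f b - f a) = (\<Sum>z\<in>p. \<Delta> z)"
        unfolding ba(2) \<Delta>_def by (simp add: sum_subtractf case_prod_unfold)
      also have "\<dots> = (\<Sum>z\<in>q. \<Delta> z) + (\<Sum>z\<in>r. \<Delta> z)"
        unfolding pqr(1) by (rule sum.union_disjoint) (use pqr in auto)
      finally have split: "(\<Sum>(x,K)\<in>p. measure lborel K *\<^sub>R g x) - (f b - f a) = (\<Sum>z\<in>q. \<Delta> z) + (\<Sum>z\<in>r. \<Delta> z)" .
      have "norm (\<Sum>z\<in>q. \<Delta> z) \<le> (\<Sum>z\<in>q. norm (f (Sup (snd z)) - f (Inf (snd z))))"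
        by (rule order_trans[OF norm_sum]) (auto simp: \<Delta>_def q_def g_def norm_minus_commute intro!: sum_mono)
      also have "\<dots> < e / 2"
      proof (rule \<delta>[THEN spec, THEN spec, THEN spec, THEN mp], intro conjI)
        have D: "interior K1 \<inter> interior K2 = {}" if "(x1,K1) \<in> p" "(x2,K2) \<in> p" "(x1,K1) \<noteq> (x2,K2)" for x1 K1 x2 K2
          using tagged_division_ofD(5)[OF p that] .
        show no: "nonoverlapping q (\<lambda>z. Inf (snd z)) (\<lambda>z. Sup (snd z))"
          unfolding nonoverlapping_def
        proof (intro conjI ballI impI)
          fix z z' assume z: "z \<in> q" "z' \<in> q" "z \<noteq> z'"
          obtain x K x' K' where zz: "z = (x,K)" "z' = (x',K')" by fastforce
          obtain u v u' v' where "K = {u..v}" "u \<le> v" "K' = {u'..v'}" "u' \<le> v'"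
            using K z zz unfolding q_def by blast
          then show "{Inf (snd z)<..<Sup (snd z)} \<inter> {Inf (snd z')<..<Sup (snd z')} = {}"
            using D[of x K x' K'] z zz by (simp add: q_def)
        next
          fix z assume "z \<in> q"
          then show "Inf (snd z) \<le> Sup (snd z)"
            using K[of "fst z" "snd z"] by (auto simp: q_def)
        qed (use pqr in auto)
        show "\<forall>z\<in>q. a \<le> Inf (snd z) \<and> Sup (snd z) \<le> b"
          using K by (fastforce simp: q_def)
        have "(\<Sum>z\<in>q. Sup (snd z) - Inf (snd z)) \<le> measure lebesgue U"
        proof (rule nonoverlapping_sum_le_measure[OF no Um])
          fix z assume "z \<in> q"
          then have "(fst z, snd z) \<in> p" "fst z \<in> N" by (auto simp: q_def)
          with fine have "snd z \<subseteq> U" by (fastforce simp: fine_def \<gamma>_def)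
          then show "{Inf (snd z)<..<Sup (snd z)} \<subseteq> U"
            using K[OF \<open>(fst z, snd z) \<in> p\<close>] by auto
        qed
        with U\<delta> show "(\<Sum>z\<in>q. Sup (snd z) - Inf (snd z)) < \<delta>" by linarith
      qed
      finally have q: "norm (\<Sum>z\<in>q. \<Delta> z) < e / 2" .
      have "norm (\<Sum>z\<in>r. \<Delta> z) \<le> (\<Sum>z\<in>r. e' * (Sup (snd z) - Inf (snd z)))"
      proof (rule sum_norm_le)
        fix z assume z: "z \<in> r"
        obtain x k where zz: "z = (x,k)" by fastforce
        then have xk: "(x,k) \<in> p" "x \<notin> N" using z by (auto simp: r_def)
        obtain u v where k: "k = {u..v}" "u \<le> v" "x \<in> k" "u \<in> {a..b}" "v \<in> {a..b}"
          using K[OF xk(1)] by blast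
        have ball: "k \<subseteq> ball x (d x)"
          using fine xk by (fastforce simp: fine_def \<gamma>_def)
        have x: "x \<in> {a..b}" using k by auto
        have uv: "norm (u - x) < d x" "norm (v - x) < d x"
          using k(2) ball[unfolded k(1), THEN subsetD, of u] ball[unfolded k(1), THEN subsetD, of v]
          by (simp_all add: dist_real_def abs_minus_commute)
        \<comment> \<open>The tag lies between \<open>u\<close> and \<open>v\<close>: the term is
          the difference of the linearisation errors at the two ends, and the distances of the ends
          to the tag add up to \<open>v - u\<close>.\<close>
        have "norm (\<Delta> z) = norm (f u - f x - (u - x) *\<^sub>R f' x - (f v - f x - (v - x) *\<^sub>R f' x))"
          using k xk by (simp add: \<Delta>_def zz g_def algebra_simps)
        also have "\<dots> \<le> norm (f u - f x - (u - x) *\<^sub>R f' x) + norm (f v - f x - (v - x) *\<^sub>R f' x)"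
          by (rule norm_triangle_ineq4)
        also have "\<dots> \<le> e' * norm (u - x) + e' * norm (v - x)"
          by (intro add_mono d(2) x xk k uv)
        also have "\<dots> = e' * (v - u)"
          using k by (simp add: algebra_simps)
        finally show "norm (\<Delta> z) \<le> e' * (Sup (snd z) - Inf (snd z))"
          using k zz by simp
      qed
      also have "\<dots> \<le> (\<Sum>z\<in>p. e' * (Sup (snd z) - Inf (snd z)))"
      proof (rule sum_mono2)
        fix z assume "z \<in> p - r"
        then show "0 \<le> e' * (Sup (snd z) - Inf (snd z))"
          using K[of "fst z" "snd z"] \<open>e' > 0\<close> by auto
      qed (use fin pqr in auto)
      also have "\<dots> = e' * (b - a)"
        by (simp add: ba(1) sum_distrib_left case_prod_unfold)
      finally have "norm (\<Sum>z\<in>r. \<Delta> z) < e / 2" using e' by linarith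
      with q show ?thesis
        unfolding split using norm_triangle_ineq[of "\<Sum>z\<in>q. \<Delta> z" "\<Sum>z\<in>r. \<Delta> z"] by linarith
    qed
    ultimately show "\<exists>\<gamma>. gauge \<gamma> \<and> (\<forall>p. p tagged_division_of {a..b} \<and> \<gamma> fine p \<longrightarrow>
        norm ((\<Sum>(x,K)\<in>p. measure lborel K *\<^sub>R g x) - (f b - f a)) < e)"
      by (intro exI[of _ \<gamma>]) auto
  qed
  then show ?thesis
    by (rule has_integral_spike[OF N, rotated]) (simp add: g_def)
qed

section \<open>Almost everywhere differentiability\<close>

lemma countable_imp_negligible: "countable A \<Longrightarrow> negligible (A :: 'a::euclidean_space set)"
  by (simp add: negligible_iff_null_sets countable_imp_null_set_lborel null_sets_completionI)

lemma nonoverlapping_insert: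
  assumes "nonoverlapping I u v" "u i \<le> v i"
    "\<And>j. j \<in> I \<Longrightarrow> {u i<..<v i} \<inter> {u j<..<v j} = {}"
  shows "nonoverlapping (insert i I) u v"
  unfolding nonoverlapping_def
proof (intro conjI ballI impI)
  fix j k assume "j \<in> insert i I" "k \<in> insert i I" "j \<noteq> k"
  then show "{u j<..<v j} \<inter> {u k<..<v k} = {}"
    using assms(1,3) unfolding nonoverlapping_def by (metis Int_commute insert_iff)
qed (use assms(1,2) in \<open>auto simp: nonoverlapping_def\<close>)

text \<open>
  Only intervals with the point strictly inside are used: this makes the set a countable
  intersection of open sets, and for continuous \<open>f\<close> it loses no information about the derivative.
\<close>

definition slope_below :: "real \<Rightarrow> real \<Rightarrow> (real \<Rightarrow> real) \<Rightarrow> real \<Rightarrow> real set" where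
  "slope_below a b f q =
     {x. \<forall>d>0. \<exists>u v. a < u \<and> u < x \<and> x < v \<and> v < b \<and> v - u < d \<and> f v - f u < q * (v - u)}"

lemma slope_below_subset: "slope_below a b f q \<subseteq> {a<..<b}"
proof
  fix x assume "x \<in> slope_below a b f q"
  then obtain u v where "a < u" "u < x" "x < v" "v < b"
    unfolding slope_below_def using zero_less_one by blast
  then show "x \<in> {a<..<b}" by simp
qed

lemma slope_below_borel: "slope_below a b f q \<in> sets borel"
proof -
  define W where "W n = \<Union>{{u<..<v} | u v. a < u \<and> v < b \<and> v - u < 1 / Suc n \<and> f v - f u < q * (v - u)}"
    for n :: nat
  have "slope_below a b f q = (\<Inter>n. W n)"
  proof (intro equalityI subsetI INT_I)
    fix x n assume "x \<in> slope_below a b f q"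
    then obtain u v where "a < u" "u < x" "x < v" "v < b" "v - u < 1 / Suc n" "f v - f u < q * (v - u)"
      unfolding slope_below_def by (auto simp del: of_nat_Suc dest: spec[of _ "1 / Suc n"])
    then show "x \<in> W n" unfolding W_def by (intro UnionI[of "{u<..<v}"]) auto
  next
    fix x assume x: "x \<in> (\<Inter>n. W n)"
    show "x \<in> slope_below a b f q"
      unfolding slope_below_def
    proof (intro CollectI allI impI)
      fix d :: real assume "d > 0"
      then obtain n where n: "1 / Suc n < d"
        using nat_approx_posE by blast
      have "x \<in> W n" using x by blast
      then obtain u v where "x \<in> {u<..<v}" "a < u" "v < b" "v - u < 1 / Suc n" "f v - f u < q * (v - u)"
        unfolding W_def by blast
      then show "\<exists>u v. a < u \<and> u < x \<and> x < v \<and> v < b \<and> v - u < d \<and> f v - f u < q * (v - u)"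
        using n by (intro exI[of _ u] exI[of _ v]) auto
    qed
  qed
  moreover have "open (W n)" for n
    unfolding W_def by (rule open_Union) auto
  ultimately show ?thesis by auto
qed

lemma slope_below_lmeasurable: "slope_below a b f q \<in> lmeasurable"
proof (rule bounded_set_imp_lmeasurable)
  show "bounded (slope_below a b f q)"
    using bounded_subset[OF bounded_box[of a b]] slope_below_subset by simp
qed (simp add: slope_below_borel)

text \<open>Closed balls of the line are closed intervals, so Vitali's theorem gives a countable
  disjoint family \<open>C\<close>. Opening the intervals loses only countably many endpoints, and a
  finite subfamily loses less than \<open>e\<close> in measure; finiteness is what makes absolute
  continuity applicable. The predicate \<open>P\<close> carries the slope conditions.\<close>

lemma Vitali_covering_intervals:
  assumes E: "E \<in> lmeasurable" and "e > 0"
    and cover: "\<And>x d. x \<in> E \<Longrightarrow> d > 0 \<Longrightarrow> \<exists>u v. u < x \<and> x < v \<and> v - u < d \<and> P u v"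
  obtains I :: "(real \<times> real) set" where "nonoverlapping I fst snd"
    "\<And>i. i \<in> I \<Longrightarrow> fst i < snd i \<and> P (fst i) (snd i)"
    "measure lebesgue E - e < measure lebesgue (E \<inter> (\<Union>i\<in>I. {fst i<..<snd i}))"
proof -
  define K where "K = {i :: real \<times> real. fst i < snd i \<and> P (fst i) (snd i)}"
  define c where "c i = (fst i + snd i) / 2" for i :: "real \<times> real"
  define r where "r i = (snd i - fst i) / 2" for i :: "real \<times> real"
  have cb: "cball (c i) (r i) = {fst i..snd i}" for i
    by (simp add: cball_eq_atLeastAtMost c_def r_def field_simps)
  obtain C where C: "countable C" "C \<subseteq> K"
     "pairwise (\<lambda>i j. disjnt (cball (c i) (r i)) (cball (c j) (r j))) C"
     "negligible(E - (\<Union>i \<in> C. cball (c i) (r i)))"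
  proof (rule Vitali_covering_theorem_cballs[of K r E c])
    show "0 < r i" if "i \<in> K" for i using that by (simp add: K_def r_def)
    show "\<exists>i. i \<in> K \<and> x \<in> cball (c i) (r i) \<and> r i < d" if x: "x \<in> E" "0 < d" for x d
    proof -
      obtain u v where "u < x" "x < v" "v - u < d" "P u v"
        using cover[OF x] by blast
      then show ?thesis
        unfolding cb by (intro exI[of _ "(u,v)"]) (auto simp: K_def r_def)
    qed
  qed blast
  have no: "nonoverlapping I fst snd" if "I \<subseteq> C" "finite I" for I
    unfolding nonoverlapping_def
  proof (intro conjI ballI impI)
    fix i j assume "i \<in> I" "j \<in> I" "i \<noteq> j"
    then have "disjnt {fst i..snd i} {fst j..snd j}"
      using C(3) that unfolding pairwise_def cb by blast
    then show "{fst i<..<snd i} \<inter> {fst j<..<snd j} = {}"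
      unfolding disjnt_iff disjoint_iff
      by (metis atLeastAtMost_iff greaterThanLessThan_iff less_imp_le)
  qed (use that C(2) in \<open>auto simp: K_def intro: less_imp_le\<close>)
  define F where "F i = E \<inter> {fst i<..<snd i}" for i :: "real \<times> real"
  have Fm: "F i \<in> lmeasurable" for i
    unfolding F_def using E by (intro fmeasurable_Int_fmeasurable) auto
  have "negligible (E - \<Union>(F ` C))"
  proof (rule negligible_subset)
    show "negligible ((E - (\<Union>i \<in> C. cball (c i) (r i))) \<union> (fst ` C \<union> snd ` C))"
      by (intro negligible_Un[OF C(4)] countable_imp_negligible) (use C(1) in auto)
    show "E - \<Union>(F ` C) \<subseteq> (E - (\<Union>i \<in> C. cball (c i) (r i))) \<union> (fst ` C \<union> snd ` C)"
    proof
      fix x assume x: "x \<in> E - \<Union>(F ` C)"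
      have "x \<in> fst ` C \<union> snd ` C" if "i \<in> C" "fst i \<le> x" "x \<le> snd i" for i
      proof -
        have "\<not> (fst i < x \<and> x < snd i)" using x that by (auto simp: F_def)
        then have "x = fst i \<or> x = snd i" using that by linarith
        then show ?thesis using that by blast
      qed
      then show "x \<in> (E - (\<Union>i \<in> C. cball (c i) (r i))) \<union> (fst ` C \<union> snd ` C)"
        unfolding cb using x by auto
    qed
  qed
  then have mE: "measure lebesgue (\<Union>(F ` C)) = measure lebesgue E"
  proof (intro measure_negligible_symdiff E)
    assume "negligible (E - \<Union>(F ` C))"
    moreover have "\<Union>(F ` C) - E = {}" by (auto simp: F_def)
    ultimately show "negligible (E - \<Union>(F ` C) \<union> (\<Union>(F ` C) - E))" by simp
  qed
  obtain D where D: "D \<subseteq> F ` C" "finite D"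
    "measure lebesgue (\<Union>(F ` C)) - e < measure lebesgue (\<Union>D)"
  proof (rule measure_countable_Union_approachable[of "F ` C" e "measure lebesgue E"])
    show "countable (F ` C)" using C by blast
    show "d \<in> lmeasurable" if "d \<in> F ` C" for d using that Fm by blast
    show "measure lebesgue (\<Union>D) \<le> measure lebesgue E" if "D \<subseteq> F ` C" "finite D" for D
      using that E Fm by (intro measure_mono_fmeasurable sets.finite_Union) (auto simp: F_def)
  qed (use \<open>e > 0\<close> in blast)+
  obtain I where I: "I \<subseteq> C" "finite I" "D = F ` I"
    using finite_subset_image[OF D(2,1)] by blast
  show thesis
  proof
    show "nonoverlapping I fst snd" by (rule no[OF I(1,2)])
    show "fst i < snd i \<and> P (fst i) (snd i)" if "i \<in> I" for i
      using that I C by (auto simp: K_def)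
    have "\<Union>D = E \<inter> (\<Union>i\<in>I. {fst i<..<snd i})"
      by (auto simp: I F_def)
    then show "measure lebesgue E - e < measure lebesgue (E \<inter> (\<Union>i\<in>I. {fst i<..<snd i}))"
      using D(3) mE by simp
  qed
qed

lemma measure_Int_UN_intervals_le:
  assumes "nonoverlapping I u v" "E \<in> lmeasurable"
  shows "measure lebesgue (E \<inter> (\<Union>i\<in>I. {u i<..<v i})) \<le> (\<Sum>i\<in>I. v i - u i)"
proof -
  have fin: "finite I" using assms(1) by (rule nonoverlapping_finite)
  have "measure lebesgue (E \<inter> (\<Union>i\<in>I. {u i<..<v i})) \<le> measure lebesgue (\<Union>i\<in>I. {u i<..<v i})"
    using fin by (intro measure_mono_fmeasurable fmeasurable.finite_UN sets.Int sets.finite_UN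
        fmeasurableD[OF assms(2)]) auto
  also have "\<dots> \<le> (\<Sum>i\<in>I. measure lebesgue {u i<..<v i})"
    using fin by (intro measure_UNION_le) auto
  also have "\<dots> = (\<Sum>i\<in>I. v i - u i)"
    using assms(1) by (intro sum.cong refl) (simp add: nonoverlapping_def)
  finally show ?thesis .
qed

text \<open>The intervals \<open>R\<close> are the gaps that \<open>J\<close> leaves in
  \<open>[c, d]\<close>, chosen independently of \<open>g\<close>: the identity then accounts for
  lengths and any other function for its increments. The induction removes the leftmost interval,
  whose right end becomes the new \<open>c\<close>.\<close>

lemma nonoverlapping_complement:
  assumes "nonoverlapping J fst snd" "c \<le> d"
    "\<And>j. j \<in> J \<Longrightarrow> c \<le> fst j \<and> fst j < snd j \<and> snd j \<le> (d::real)"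
  shows "\<exists>R. nonoverlapping R fst snd \<and> (\<forall>r\<in>R. c \<le> fst r \<and> snd r \<le> d) \<and>
    (\<forall>g::real \<Rightarrow> real. (\<Sum>j\<in>J. g (snd j) - g (fst j)) + (\<Sum>r\<in>R. g (snd r) - g (fst r)) = g d - g c)"
  using assms
proof (induction "card J" arbitrary: J c)
  case 0
  then have "J = {}" using nonoverlapping_finite by fastforce
  then show ?case
    using \<open>c \<le> d\<close> by (intro exI[of _ "{(c,d)}"]) (auto simp: nonoverlapping_def)
next
  case (Suc n)
  have fin: "finite J" using Suc.prems(1) by (rule nonoverlapping_finite)
  moreover have "J \<noteq> {}" using Suc.hyps(2) by auto
  ultimately obtain j where j: "j \<in> J" "\<And>i. i \<in> J \<Longrightarrow> fst j \<le> fst i"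
    using arg_min_if_finite[of J fst] by (metis not_le)
  define J' where "J' = J - {j}"
  have J': "snd j \<le> fst i" if "i \<in> J'" for i
  proof (rule ccontr)
    assume "\<not> snd j \<le> fst i"
    moreover have i: "i \<in> J" "i \<noteq> j" using that by (auto simp: J'_def)
    moreover have "fst i < snd i" "fst j < snd j" "fst j \<le> fst i"
      using Suc.prems(3) i j by auto
    \<comment> \<open>Points slightly to the right of \<open>fst i\<close> would lie in both
      intervals.\<close>
    ultimately obtain y where "fst i < y" "y < min (snd i) (snd j)"
      using dense[of "fst i" "min (snd i) (snd j)"] by auto
    then have "y \<in> {fst i<..<snd i} \<inter> {fst j<..<snd j}"
      using \<open>fst j \<le> fst i\<close> by auto
    then show False
      using Suc.prems(1) i j(1) unfolding nonoverlapping_def by blast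
  qed
  have "\<exists>R. nonoverlapping R fst snd \<and> (\<forall>r\<in>R. snd j \<le> fst r \<and> snd r \<le> d) \<and>
    (\<forall>g::real \<Rightarrow> real. (\<Sum>j\<in>J'. g (snd j) - g (fst j)) + (\<Sum>r\<in>R. g (snd r) - g (fst r)) = g d - g (snd j))"
  proof (rule Suc.hyps(1))
    show "n = card J'" using Suc.hyps(2) j fin by (simp add: J'_def)
    show "nonoverlapping J' fst snd"
      using nonoverlapping_subset[OF Suc.prems(1)] by (auto simp: J'_def)
    show "snd j \<le> d" using Suc.prems(3) j by auto
    show "snd j \<le> fst i \<and> fst i < snd i \<and> snd i \<le> d" if "i \<in> J'" for i
      using Suc.prems(3) that J' by (auto simp: J'_def)
  qed
  then obtain R where R: "nonoverlapping R fst snd" "\<And>r. r \<in> R \<Longrightarrow> snd j \<le> fst r \<and> snd r \<le> d"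
    "\<And>g::real \<Rightarrow> real. (\<Sum>j\<in>J'. g (snd j) - g (fst j)) + (\<Sum>r\<in>R. g (snd r) - g (fst r)) = g d - g (snd j)"
    by blast
  have cj: "c \<le> fst j" "fst j < snd j" using Suc.prems(3) j by auto
  show ?case
  proof (intro exI[of _ "insert (c, fst j) R"] conjI ballI allI)
    have notin: "(c, fst j) \<notin> R"
      using R(2)[of "(c, fst j)"] cj by auto
    have finR: "finite R" using R(1) by (rule nonoverlapping_finite)
    have dis: "{c<..<fst j} \<inter> {fst r<..<snd r} = {}" if "r \<in> R" for r
      using R(2)[OF that] cj by auto
    show "nonoverlapping (insert (c, fst j) R) fst snd"
      by (rule nonoverlapping_insert[OF R(1)]) (use cj dis in auto)
    show "c \<le> fst r" if "r \<in> insert (c, fst j) R" for r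
      using that R(2)[of r] cj by (cases "r = (c, fst j)") auto
    show "snd r \<le> d" if "r \<in> insert (c, fst j) R" for r
      using that R(2)[of r] cj Suc.prems(3)[OF j(1)] by (cases "r = (c, fst j)") auto
    fix g :: "real \<Rightarrow> real"
    have "(\<Sum>j\<in>J. g (snd j) - g (fst j)) = (g (snd j) - g (fst j)) + (\<Sum>j\<in>J'. g (snd j) - g (fst j))"
      unfolding J'_def using fin j(1) by (rule sum.remove)
    then show "(\<Sum>j\<in>J. g (snd j) - g (fst j)) + (\<Sum>r\<in>insert (c, fst j) R. g (snd r) - g (fst r)) = g d - g c"
      using R(3)[of g] notin finR by simp
  qed
qed

text \<open>
  Two nested Vitali coverings: first by intervals of slope less than \<open>q\<close> whose total length barely exceeds
  the measure of the set, then, inside these, by intervals of slope greater than \<open>p\<close>. What is left between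
  the two families is short, so by absolute continuity it cannot compensate the difference of the slopes.
\<close>

lemma negligible_two_slopes:
  assumes ac: "absolutely_continuous_curve a b f" and "q < p"
  shows "negligible (slope_below a b f q \<inter> slope_below a b (\<lambda>x. - f x) (- p))"
proof (rule ccontr)
  define E where "E = slope_below a b f q \<inter> slope_below a b (\<lambda>x. - f x) (- p)"
  assume "\<not> negligible (slope_below a b f q \<inter> slope_below a b (\<lambda>x. - f x) (- p))"
  then have nneg: "\<not> negligible E" by (simp add: E_def)
  have E: "E \<in> lmeasurable"
    unfolding E_def by (intro fmeasurable_Int_fmeasurable fmeasurableD slope_below_lmeasurable)
  define m where "m = measure lebesgue E"
  have "m > 0"
    using nneg E unfolding m_def by (simp add: negligible_iff_measure less_le)
  \<comment> \<open>The argument ends with \<open>(p - q) * m < \<eta> + k * e\<close>, where each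
    summand on the right is at most a quarter of the left-hand side.\<close>
  define \<eta> where "\<eta> = (p - q) * m / 4"
  have "\<eta> > 0" using \<open>m > 0\<close> \<open>q < p\<close> by (simp add: \<eta>_def)
  obtain \<delta> where "\<delta> > 0" and \<delta>: "\<forall>(I::((real \<times> real) \<times> real \<times> real) set) u v. nonoverlapping I u v \<and>
        (\<forall>i\<in>I. a \<le> u i \<and> v i \<le> b) \<and>
        (\<Sum>i\<in>I. v i - u i) < \<delta> \<longrightarrow> (\<Sum>i\<in>I. norm (f (v i) - f (u i))) < \<eta>"
    using absolutely_continuous_curveE[OF ac \<open>\<eta> > 0\<close>] by blast
  \<comment> \<open>The part \<open>2 * (p - q)\<close> comes from the measure \<open>2 * e\<close>
    lost by the two coverings, the part with \<open>3\<close> from the bound \<open>3 * e\<close> on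
    the total length of the gaps.\<close>
  define k where "k = 2 * (p - q) + 3 * \<bar>q\<bar>"
  have "k > 0" using \<open>q < p\<close> by (simp add: k_def)
  \<comment> \<open>The first bound keeps the total length of the gaps below
    \<open>\<delta>\<close>; the second makes \<open>k * e\<close> at most a quarter of
    \<open>(p - q) * m\<close>.\<close>
  define e where "e = min (\<delta> / 3) ((p - q) * m / (4 * k))"
  have "e > 0" using \<open>\<delta> > 0\<close> \<open>k > 0\<close> \<open>m > 0\<close> \<open>q < p\<close> by (simp add: e_def)
  have e\<delta>: "3 * e \<le> \<delta>" by (simp add: e_def)
  have ek: "k * e \<le> (p - q) * m / 4"
  proof -
    have "k * e \<le> k * ((p - q) * m / (4 * k))"
      using \<open>k > 0\<close> by (intro mult_left_mono) (auto simp: e_def)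
    then show ?thesis using \<open>k > 0\<close> by simp
  qed
  obtain U where U: "open U" "E \<subseteq> U" "U - E \<in> lmeasurable" "emeasure lebesgue (U - E) < ennreal e"
    using sets_lebesgue_outer_open[OF fmeasurableD[OF E] \<open>e > 0\<close>] by blast
  have UE: "U = E \<union> (U - E)" using U(2) by blast
  have Um: "U \<in> lmeasurable" using fmeasurable.Un[OF E U(3)] UE by simp
  have "ennreal (measure lebesgue (U - E)) < ennreal e"
    using U(3,4) by (simp add: emeasure_eq_measure2)
  then have "measure lebesgue (U - E) < e"
    by (simp add: ennreal_less_iff)
  moreover have "measure lebesgue U = m + measure lebesgue (U - E)"
    using measurable_measure_Diff[OF Um fmeasurableD[OF E] U(2)] by (simp add: m_def)
  ultimately have mU: "measure lebesgue U < m + e" by linarith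

  obtain I where I: "nonoverlapping I fst snd"
    "\<And>i. i \<in> I \<Longrightarrow> fst i < snd i \<and> a < fst i \<and> snd i < b \<and> {fst i<..<snd i} \<subseteq> U \<and> f (snd i) - f (fst i) < q * (snd i - fst i)"
    "measure lebesgue E - e < measure lebesgue (E \<inter> (\<Union>i\<in>I. {fst i<..<snd i}))"
  proof (rule Vitali_covering_intervals[OF E \<open>e > 0\<close>,
        of "\<lambda>u v. a < u \<and> v < b \<and> {u<..<v} \<subseteq> U \<and> f v - f u < q * (v - u)"])
    fix x d :: real assume x: "x \<in> E" "d > 0"
    obtain d' where d': "d' > 0" "ball x d' \<subseteq> U"
      using U(1,2) x(1) by (meson open_contains_ball subsetD)
    obtain u v where uv: "a < u" "u < x" "x < v" "v < b" "v - u < min d d'" "f v - f u < q * (v - u)"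
      using x d'(1) unfolding E_def slope_below_def by (auto dest: spec[of _ "min d d'"])
    have "{u<..<v} \<subseteq> ball x d'"
      using uv by (auto simp: dist_real_def)
    with uv d' show "\<exists>u v. u < x \<and> x < v \<and> v - u < d \<and> (a < u \<and> v < b \<and> {u<..<v} \<subseteq> U \<and> f v - f u < q * (v - u))"
      by (intro exI[of _ u] exI[of _ v] conjI) simp_all
  qed blast
  have finI: "finite I" using I(1) by (rule nonoverlapping_finite)
  define A where "A = (\<Sum>i\<in>I. snd i - fst i)"
  have A: "A < m + e"
    using nonoverlapping_sum_le_measure[OF I(1) Um] I(2) mU by (fastforce simp: A_def)
  define E1 where "E1 = E \<inter> (\<Union>i\<in>I. {fst i<..<snd i})"
  have E1: "E1 \<in> lmeasurable"
    unfolding E1_def using finI by (intro fmeasurable_Int_fmeasurable E sets.finite_UN) auto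

  obtain J where J: "nonoverlapping J fst snd"
    "\<And>j. j \<in> J \<Longrightarrow> fst j < snd j \<and> (\<exists>i\<in>I. fst i < fst j \<and> snd j < snd i) \<and> p * (snd j - fst j) < f (snd j) - f (fst j)"
    "measure lebesgue E1 - e < measure lebesgue (E1 \<inter> (\<Union>i\<in>J. {fst i<..<snd i}))"
  proof (rule Vitali_covering_intervals[OF E1 \<open>e > 0\<close>,
        of "\<lambda>u v. (\<exists>i\<in>I. fst i < u \<and> v < snd i) \<and> p * (v - u) < f v - f u"])
    fix x d :: real assume x: "x \<in> E1" "d > 0"
    then obtain i where i: "i \<in> I" "fst i < x" "x < snd i" by (auto simp: E1_def)
    define d' where "d' = min d (min (x - fst i) (snd i - x))"
    have "d' > 0" using i x by (simp add: d'_def)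
    moreover have "x \<in> slope_below a b (\<lambda>x. - f x) (- p)" using x by (simp add: E1_def E_def)
    ultimately obtain u v where uv: "u < x" "x < v" "v - u < d'" "- f v - (- f u) < - p * (v - u)"
      unfolding slope_below_def by blast
    have "fst i < u" "v < snd i" "v - u < d" using uv by (auto simp: d'_def)
    moreover have "p * (v - u) < f v - f u" using uv(4) by simp
    ultimately show "\<exists>u v. u < x \<and> x < v \<and> v - u < d \<and> ((\<exists>i\<in>I. fst i < u \<and> v < snd i) \<and> p * (v - u) < f v - f u)"
      using uv i(1) by blast
  qed blast
  have finJ: "finite J" using J(1) by (rule nonoverlapping_finite)
  define B where "B = (\<Sum>j\<in>J. snd j - fst j)"
  have B: "m - 2 * e < B"
    using measure_Int_UN_intervals_le[OF J(1) E1] J(3) I(3) unfolding E1_def[symmetric] m_def[symmetric]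
    by (simp add: B_def)
  obtain h where h: "\<And>j. j \<in> J \<Longrightarrow> h j \<in> I \<and> fst (h j) < fst j \<and> snd j < snd (h j)"
    using J(2) by metis

  have "\<forall>i\<in>I. \<exists>R. nonoverlapping R fst snd \<and> (\<forall>r\<in>R. fst i \<le> fst r \<and> snd r \<le> snd i) \<and>
    (\<forall>g::real \<Rightarrow> real. (\<Sum>j\<in>{j\<in>J. h j = i}. g (snd j) - g (fst j)) + (\<Sum>r\<in>R. g (snd r) - g (fst r)) = g (snd i) - g (fst i))"
  proof
    fix i assume i: "i \<in> I"
    show "\<exists>R. nonoverlapping R fst snd \<and> (\<forall>r\<in>R. fst i \<le> fst r \<and> snd r \<le> snd i) \<and>
    (\<forall>g::real \<Rightarrow> real. (\<Sum>j\<in>{j\<in>J. h j = i}. g (snd j) - g (fst j)) + (\<Sum>r\<in>R. g (snd r) - g (fst r)) = g (snd i) - g (fst i))"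
    proof (rule nonoverlapping_complement)
      show "nonoverlapping {j\<in>J. h j = i} fst snd"
        using nonoverlapping_subset[OF J(1)] by auto
      show "fst i \<le> snd i" using I(2)[OF i] by simp
      show "fst i \<le> fst j \<and> fst j < snd j \<and> snd j \<le> snd i" if "j \<in> {j\<in>J. h j = i}" for j
        using that h[of j] J(2)[of j] by auto
    qed
  qed
  from bchoice[OF this] obtain R where R': "\<forall>i\<in>I. nonoverlapping (R i) fst snd \<and>
    (\<forall>r\<in>R i. fst i \<le> fst r \<and> snd r \<le> snd i) \<and>
    (\<forall>g::real \<Rightarrow> real. (\<Sum>j\<in>{j\<in>J. h j = i}. g (snd j) - g (fst j)) + (\<Sum>r\<in>R i. g (snd r) - g (fst r)) = g (snd i) - g (fst i))"
    by blast
  have R: "\<And>i. i \<in> I \<Longrightarrow> nonoverlapping (R i) fst snd"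
    "\<And>i r. i \<in> I \<Longrightarrow> r \<in> R i \<Longrightarrow> fst i \<le> fst r \<and> snd r \<le> snd i"
    "\<And>i (g::real\<Rightarrow>real). i \<in> I \<Longrightarrow>
       (\<Sum>j\<in>{j\<in>J. h j = i}. g (snd j) - g (fst j)) + (\<Sum>r\<in>R i. g (snd r) - g (fst r)) = g (snd i) - g (fst i)"
    using R' by blast+
  \<comment> \<open>Labelling each gap by its interval makes the double sum a single sum, without
    having to know that gaps of different intervals are distinct pairs.\<close>
  define Q where "Q = Sigma I R"
  have total: "(\<Sum>i\<in>I. g (snd i) - g (fst i)) =
     (\<Sum>j\<in>J. g (snd j) - g (fst j)) + (\<Sum>z\<in>Q. g (snd (snd z)) - g (fst (snd z)))" for g :: "real \<Rightarrow> real"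
  proof -
    have "(\<Sum>i\<in>I. g (snd i) - g (fst i)) =
      (\<Sum>i\<in>I. (\<Sum>j\<in>{j\<in>J. h j = i}. g (snd j) - g (fst j)) + (\<Sum>r\<in>R i. g (snd r) - g (fst r)))"
      using R(3)[of _ g] by (intro sum.cong refl) simp
    also have "\<dots> = (\<Sum>i\<in>I. \<Sum>j\<in>{j\<in>J. h j = i}. g (snd j) - g (fst j)) + (\<Sum>i\<in>I. \<Sum>r\<in>R i. g (snd r) - g (fst r))"
      by (rule sum.distrib)
    also have "(\<Sum>i\<in>I. \<Sum>j\<in>{j\<in>J. h j = i}. g (snd j) - g (fst j)) = (\<Sum>j\<in>J. g (snd j) - g (fst j))"
      using h by (intro sum.group finI finJ) auto
    also have "(\<Sum>i\<in>I. \<Sum>r\<in>R i. g (snd r) - g (fst r)) = (\<Sum>z\<in>Q. g (snd (snd z)) - g (fst (snd z)))"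
      unfolding Q_def using finI R(1)[THEN nonoverlapping_finite]
      by (subst sum.Sigma) (auto simp: case_prod_unfold)
    finally show ?thesis .
  qed
  have Q: "nonoverlapping Q (\<lambda>z. fst (snd z)) (\<lambda>z. snd (snd z))"
    unfolding nonoverlapping_def
  proof (intro conjI ballI impI)
    show "finite Q"
      unfolding Q_def using finI R(1)[THEN nonoverlapping_finite] by blast
    show "fst (snd z) \<le> snd (snd z)" if "z \<in> Q" for z
    proof -
      have "fst z \<in> I" "snd z \<in> R (fst z)" using that by (auto simp: Q_def)
      then show ?thesis using R(1) unfolding nonoverlapping_def by blast
    qed
    fix z z' assume z: "z \<in> Q" "z' \<in> Q" "z \<noteq> z'"
    obtain i r i' r' where zz: "z = (i, r)" "z' = (i', r')" by (metis surj_pair)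
    have mem: "i \<in> I" "r \<in> R i" "i' \<in> I" "r' \<in> R i'" using z zz by (auto simp: Q_def)
    show "{fst (snd z)<..<snd (snd z)} \<inter> {fst (snd z')<..<snd (snd z')} = {}"
    proof (cases "i = i'")
      case True
      then show ?thesis
        using R(1)[OF mem(1)] mem z(3) unfolding zz nonoverlapping_def by auto
    next
      case False
      then have "{fst i<..<snd i} \<inter> {fst i'<..<snd i'} = {}"
        using I(1) mem unfolding nonoverlapping_def by blast
      moreover have "{fst r<..<snd r} \<subseteq> {fst i<..<snd i}" "{fst r'<..<snd r'} \<subseteq> {fst i'<..<snd i'}"
        using R(2)[OF mem(1,2)] R(2)[OF mem(3,4)] by auto
      ultimately show ?thesis unfolding zz by (simp only: fst_conv snd_conv) blast
    qed
  qed
  have "(\<Sum>z\<in>Q. snd (snd z) - fst (snd z)) = A - B"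
    using total[of "\<lambda>x. x"] by (simp add: A_def B_def)
  also have AB: "A - B < 3 * e" using A B by linarith
  finally have small: "(\<Sum>z\<in>Q. snd (snd z) - fst (snd z)) < \<delta>" using e\<delta> by linarith
  have "0 \<le> (\<Sum>z\<in>Q. snd (snd z) - fst (snd z))"
    using Q by (intro sum_nonneg) (auto simp: nonoverlapping_def)
  then have "B \<le> A"
    using total[of "\<lambda>x. x"] by (simp add: A_def B_def)
  have "(\<Sum>z\<in>Q. norm (f (snd (snd z)) - f (fst (snd z)))) < \<eta>"
  proof (rule \<delta>[THEN spec, THEN spec, THEN spec, THEN mp], intro conjI)
    show "\<forall>z\<in>Q. a \<le> fst (snd z) \<and> snd (snd z) \<le> b"
    proof
      fix z assume "z \<in> Q"
      then show "a \<le> fst (snd z) \<and> snd (snd z) \<le> b"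
        using R(2)[of "fst z" "snd z"] I(2)[of "fst z"] by (auto simp: Q_def)
    qed
  qed (use Q small in auto)
  then have "\<bar>\<Sum>z\<in>Q. f (snd (snd z)) - f (fst (snd z))\<bar> < \<eta>"
    unfolding real_norm_def by (rule le_less_trans[OF sum_abs])
  moreover have "(\<Sum>i\<in>I. f (snd i) - f (fst i)) \<le> q * A"
    unfolding A_def sum_distrib_left using I(2) by (intro sum_mono) (auto intro: less_imp_le)
  moreover have "p * B \<le> (\<Sum>j\<in>J. f (snd j) - f (fst j))"
    unfolding B_def sum_distrib_left using J(2) by (intro sum_mono) (auto intro: less_imp_le)
  \<comment> \<open>The increments over \<open>I\<close>, at most \<open>q * A\<close>, split into
    those over \<open>J\<close>, at least \<open>p * B\<close>, and those over the gaps, greater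
    than \<open>- \<eta>\<close>.\<close>
  ultimately have "p * B - \<eta> < q * A"
    using total[of f] by linarith
  then have "(p - q) * B < \<eta> + q * (A - B)" by (simp add: algebra_simps)
  \<comment> \<open>The sign of \<open>q\<close> is unknown, hence the absolute value.\<close>
  also have "q * (A - B) \<le> \<bar>q\<bar> * (3 * e)"
    using AB \<open>B \<le> A\<close> by (intro mult_mono) auto
  finally have "(p - q) * B < \<eta> + \<bar>q\<bar> * (3 * e)" by simp
  moreover have "(p - q) * (m - 2 * e) \<le> (p - q) * B"
    using B \<open>q < p\<close> by (intro mult_left_mono) auto
  ultimately have "(p - q) * m < \<eta> + k * e"
    by (simp add: k_def algebra_simps)
  also have "\<dots> \<le> (p - q) * m / 4 + (p - q) * m / 4"
    unfolding \<eta>_def using ek by (rule add_left_mono)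
  finally show False
    using \<open>m > 0\<close> \<open>q < p\<close> by (simp add: field_simps)
qed

text \<open>Intervals of slope below \<open>- n\<close> and total length above \<open>m / 2\<close>
  carry increments of total size at least \<open>n * m / 2\<close>, which exceeds 1 for large
  \<open>n\<close>. Absolute continuity only speaks of short families, so the argument is localised
  to balls of radius \<open>\<delta> / 3\<close>, whose length is less than
  \<open>\<delta>\<close>.\<close>

lemma negligible_unbounded_slopes:
  assumes ac: "absolutely_continuous_curve a b f"
  shows "negligible (\<Inter>n::nat. slope_below a b f (- real n))"
proof -
  define E where "E = (\<Inter>n::nat. slope_below a b f (- real n))"
  obtain \<delta> where "\<delta> > 0" and \<delta>: "\<forall>(I::(real \<times> real) set) u v. nonoverlapping I u v \<and>
        (\<forall>i\<in>I. a \<le> u i \<and> v i \<le> b) \<and>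
        (\<Sum>i\<in>I. v i - u i) < \<delta> \<longrightarrow> (\<Sum>i\<in>I. norm (f (v i) - f (u i))) < 1"
    using absolutely_continuous_curveE[OF ac zero_less_one] by blast
  have "E \<in> sets lebesgue"
    unfolding E_def by (intro sets.countable_INT'' ) (auto intro: fmeasurableD slope_below_lmeasurable)
  have "negligible (E \<inter> ball x (\<delta> / 3))" for x
  proof (rule ccontr)
    define F where "F = E \<inter> ball x (\<delta> / 3)"
    assume "\<not> negligible (E \<inter> ball x (\<delta> / 3))"
    then have nneg: "\<not> negligible F" by (simp add: F_def)
    have F: "F \<in> lmeasurable"
      unfolding F_def using \<open>E \<in> sets lebesgue\<close> by (metis Int_commute fmeasurable_Int_fmeasurable lmeasurable_ball)
    define m where "m = measure lebesgue F"
    have "m > 0"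
      using nneg F unfolding m_def by (simp add: negligible_iff_measure less_le)
    obtain n :: nat where n: "2 / m < real n" using reals_Archimedean2 by blast
    have "0 < m / 2" using \<open>m > 0\<close> by simp
    obtain I where I: "nonoverlapping I fst snd"
      "\<And>i. i \<in> I \<Longrightarrow> fst i < snd i \<and> a < fst i \<and> snd i < b \<and> {fst i<..<snd i} \<subseteq> ball x (\<delta> / 3) \<and>
          f (snd i) - f (fst i) < - real n * (snd i - fst i)"
      "measure lebesgue F - m / 2 < measure lebesgue (F \<inter> (\<Union>i\<in>I. {fst i<..<snd i}))"
    proof (rule Vitali_covering_intervals[OF F \<open>0 < m / 2\<close>,
          of "\<lambda>u v. a < u \<and> v < b \<and> {u<..<v} \<subseteq> ball x (\<delta> / 3) \<and> f v - f u < - real n * (v - u)"])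
      fix y d :: real assume y: "y \<in> F" "d > 0"
      define d' where "d' = min d (\<delta> / 3 - dist x y)"
      have "d' > 0" using y by (simp add: d'_def F_def)
      moreover have "y \<in> slope_below a b f (- real n)" using y by (auto simp: E_def F_def)
      ultimately obtain u v where uv: "a < u" "u < y" "y < v" "v < b" "v - u < d'" "f v - f u < - real n * (v - u)"
        unfolding slope_below_def by blast
      have "{u<..<v} \<subseteq> ball x (\<delta> / 3)"
      proof
        fix w assume "w \<in> {u<..<v}"
        moreover have "v - u < \<delta> / 3 - \<bar>x - y\<bar>"
          using uv(5) by (simp add: d'_def dist_real_def)
        moreover have "\<bar>y - w\<bar> < v - u" using calculation(1) uv by auto
        ultimately have "\<bar>x - w\<bar> < \<delta> / 3" by linarith
        then show "w \<in> ball x (\<delta> / 3)" by (simp add: dist_real_def)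
      qed
      moreover have "v - u < d" using uv by (simp add: d'_def)
      ultimately show "\<exists>u v. u < y \<and> y < v \<and> v - u < d \<and>
          (a < u \<and> v < b \<and> {u<..<v} \<subseteq> ball x (\<delta> / 3) \<and> f v - f u < - real n * (v - u))"
        using uv by blast
    qed blast
    define A where "A = (\<Sum>i\<in>I. snd i - fst i)"
    have "A \<le> measure lebesgue (ball x (\<delta> / 3))"
      unfolding A_def using I(2) by (intro nonoverlapping_sum_le_measure[OF I(1)]) auto
    also have "\<dots> = 2 * (\<delta> / 3)"
      using \<open>\<delta> > 0\<close> by (simp add: ball_eq_greaterThanLessThan)
    finally have "A < \<delta>" using \<open>\<delta> > 0\<close> by linarith
    have "m / 2 < A"
      using measure_Int_UN_intervals_le[OF I(1) F] I(3) by (simp add: A_def m_def)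
    have "(\<Sum>i\<in>I. norm (f (snd i) - f (fst i))) < 1"
      by (rule \<delta>[THEN spec, THEN spec, THEN spec, THEN mp], intro conjI ballI)
        (use I \<open>A < \<delta>\<close> in \<open>auto simp: A_def intro: less_imp_le\<close>)
    moreover have "real n * A \<le> (\<Sum>i\<in>I. norm (f (snd i) - f (fst i)))"
      unfolding A_def sum_distrib_left
    proof (intro sum_mono)
      fix i assume "i \<in> I"
      then have "f (snd i) - f (fst i) < - real n * (snd i - fst i)" using I(2) by blast
      then show "real n * (snd i - fst i) \<le> norm (f (snd i) - f (fst i))" by simp
    qed
    moreover have "1 \<le> real n * (m / 2)"
      using n \<open>m > 0\<close> by (simp add: field_simps)
    moreover have "real n * (m / 2) \<le> real n * A"
      using \<open>m / 2 < A\<close> by (intro mult_left_mono) auto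
    ultimately show False by linarith
  qed
  moreover have "openin (top_of_set E) (E \<inter> ball x (\<delta> / 3)) \<and> x \<in> E \<inter> ball x (\<delta> / 3)" if "x \<in> E" for x
    using that \<open>\<delta> > 0\<close> by (auto intro: openin_open_Int)
  \<comment> \<open>A set that is null near each of its points is null.\<close>
  ultimately have "negligible E"
    unfolding locally_negligible_alt[of E] by meson
  then show ?thesis by (simp add: E_def)
qed

section \<open>From slope bounds to differentiability\<close>

lemma not_slope_belowD:
  assumes "x \<notin> slope_below a b f q"
  obtains d where "d > 0"
    "\<And>u v. a < u \<Longrightarrow> u < x \<Longrightarrow> x < v \<Longrightarrow> v < b \<Longrightarrow> v - u < d \<Longrightarrow> q * (v - u) \<le> f v - f u"
proof -
  obtain d where "d > 0"
    and d: "\<not> (\<exists>u v. a < u \<and> u < x \<and> x < v \<and> v < b \<and> v - u < d \<and> f v - f u < q * (v - u))"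
    using assms unfolding slope_below_def by blast
  show ?thesis
    by (rule that[OF \<open>d > 0\<close>]) (meson d not_less)
qed

text \<open>Keep one end of the interval fixed at \<open>y\<close> and let the other tend to
  \<open>x\<close>: continuity of \<open>f\<close> turns the estimate on intervals around
  \<open>x\<close> into one for \<open>f y - f x\<close>.\<close>

lemma differentiable_if_straddle:
  fixes f :: "real \<Rightarrow> real"
  assumes cont: "continuous_on {a..b} f" and x: "a < x" "x < b"
    and straddle: "\<And>e. e > 0 \<Longrightarrow> \<exists>d>0. \<forall>u v. a < u \<and> u < x \<and> x < v \<and> v < b \<and> v - u < d \<longrightarrow>
       \<bar>f v - f u - D * (v - u)\<bar> \<le> e * (v - u)"
  shows "(f has_real_derivative D) (at x)"
  unfolding has_field_derivative_def has_derivative_at_alt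
proof (intro conjI allI impI bounded_linear_mult_right)
  fix e :: real assume "e > 0"
  then obtain d where "d > 0" and d: "\<And>u v. a < u \<Longrightarrow> u < x \<Longrightarrow> x < v \<Longrightarrow> v < b \<Longrightarrow> v - u < d \<Longrightarrow>
       \<bar>f v - f u - D * (v - u)\<bar> \<le> e * (v - u)"
    using straddle by metis
  have isc: "(f \<longlongrightarrow> f x) (at x)"
    using continuous_on_interior[OF cont, of x] x by (simp add: isCont_def)
  \<comment> \<open>With \<open>d / 2\<close> on either side of \<open>x\<close>, the whole interval
    is shorter than \<open>d\<close>.\<close>
  define d' where "d' = min (d / 2) (min (x - a) (b - x))"
  have "d' > 0" using \<open>d > 0\<close> x by (simp add: d'_def)
  have "norm (f y - f x - D * (y - x)) \<le> e * norm (y - x)" if y: "norm (y - x) < d'" for y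
  proof -
    consider "y = x" | "y > x" | "y < x" by linarith
    then show ?thesis
    proof cases
      case 2
      have "\<forall>\<^sub>F u in at_left x. u \<in> {max a (x - d / 2)<..<x}"
        using x \<open>d > 0\<close> by (intro eventually_at_leftI[of "max a (x - d / 2)"]) auto
      then have ev: "\<forall>\<^sub>F u in at_left x. \<bar>f y - f u - D * (y - u)\<bar> \<le> e * (y - u)"
      proof eventually_elim
        case (elim u)
        then show ?case using 2 y by (intro d) (auto simp: d'_def)
      qed
      have "\<bar>f y - f x - D * (y - x)\<bar> \<le> e * (y - x)"
      proof (rule tendsto_le[OF _ _ _ ev])
        have l: "(f \<longlongrightarrow> f x) (at_left x)" using isc by (simp add: filterlim_at_split)
        show "((\<lambda>u. \<bar>f y - f u - D * (y - u)\<bar>) \<longlongrightarrow> \<bar>f y - f x - D * (y - x)\<bar>) (at_left x)"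
          by (intro tendsto_intros l)
        show "((\<lambda>u. e * (y - u)) \<longlongrightarrow> e * (y - x)) (at_left x)"
          by (intro tendsto_intros)
      qed simp
      then show ?thesis using 2 by simp
    next
      case 3
      have "\<forall>\<^sub>F v in at_right x. v \<in> {x<..<min b (x + d / 2)}"
        using x \<open>d > 0\<close> by (intro eventually_at_rightI[of _ "min b (x + d / 2)"]) auto
      then have ev: "\<forall>\<^sub>F v in at_right x. \<bar>f v - f y - D * (v - y)\<bar> \<le> e * (v - y)"
      proof eventually_elim
        case (elim v)
        then show ?case using 3 y by (intro d) (auto simp: d'_def)
      qed
      have "\<bar>f x - f y - D * (x - y)\<bar> \<le> e * (x - y)"
      proof (rule tendsto_le[OF _ _ _ ev])
        have l: "(f \<longlongrightarrow> f x) (at_right x)" using isc by (simp add: filterlim_at_split)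
        show "((\<lambda>u. \<bar>f u - f y - D * (u - y)\<bar>) \<longlongrightarrow> \<bar>f x - f y - D * (x - y)\<bar>) (at_right x)"
          by (intro tendsto_intros l)
        show "((\<lambda>u. e * (u - y)) \<longlongrightarrow> e * (x - y)) (at_right x)"
          by (intro tendsto_intros)
      qed simp
      moreover have "\<bar>f x - f y - D * (x - y)\<bar> = \<bar>f y - f x - D * (y - x)\<bar>"
        by (subst abs_minus_cancel[symmetric]) (simp add: algebra_simps)
      ultimately show ?thesis using 3 by simp
    qed simp
  qed
  with \<open>d' > 0\<close> show "\<exists>d>0. \<forall>y. norm (y - x) < d \<longrightarrow> norm (f y - f x - D * (y - x)) \<le> e * norm (y - x)"
    by blast
qed

text \<open>Off \<open>N1\<close> and \<open>N2\<close> the slopes over short intervals around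
  \<open>x\<close> are bounded below and above. Their lower limit is \<open>D\<close>; off
  \<open>N3\<close> no two rationals separate it from the upper limit, so both agree. Restricting to
  rational slopes keeps the union defining \<open>N3\<close> countable.\<close>

theorem absolutely_continuous_differentiable_ae:
  fixes f :: "real \<Rightarrow> real"
  assumes ac: "absolutely_continuous_curve a b f"
  obtains N where "negligible N" "\<And>x. x \<in> {a..b} - N \<Longrightarrow> a < x \<and> x < b \<and> f differentiable at x"
proof
  let ?g = "\<lambda>x. - f x"
  define N1 where "N1 = (\<Inter>n::nat. slope_below a b f (- real n))"
  define N2 where "N2 = (\<Inter>n::nat. slope_below a b ?g (- real n))"
  define N3 where "N3 = (\<Union>(q,p)\<in>{z\<in>\<rat> \<times> \<rat>. fst z < snd z}. slope_below a b f q \<inter> slope_below a b ?g (- p))"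
  have acg: "absolutely_continuous_curve a b ?g"
    by (rule absolutely_continuous_curve_Lipschitz_compose[OF ac, of 1]) (auto simp: abs_minus_commute)
  have "negligible N3"
    unfolding N3_def
  proof (rule negligible_countable_Union)
    have "countable (\<rat> \<times> \<rat> :: (real \<times> real) set)" by (intro countable_SIGMA countable_rat)
    then show "countable ((\<lambda>(q,p). slope_below a b f q \<inter> slope_below a b ?g (- p)) ` {z\<in>\<rat> \<times> \<rat>. fst z < snd z})"
      by (intro countable_image countable_subset[of "{z\<in>\<rat> \<times> \<rat>. fst z < snd z}" "\<rat> \<times> \<rat>"]) auto
  qed (auto intro: negligible_two_slopes[OF ac])
  then show "negligible ({a, b} \<union> N1 \<union> N2 \<union> N3)"
    using negligible_unbounded_slopes[OF ac] negligible_unbounded_slopes[OF acg]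
    by (simp add: N1_def N2_def)
  fix x assume "x \<in> {a..b} - ({a, b} \<union> N1 \<union> N2 \<union> N3)"
  then have x: "a < x" "x < b" "x \<notin> N1" "x \<notin> N2" "x \<notin> N3" by auto
  obtain n1 n2 :: nat where n1: "x \<notin> slope_below a b f (- real n1)" and n2: "x \<notin> slope_below a b ?g (- real n2)"
    using x unfolding N1_def N2_def by blast
  \<comment> \<open>Both slope bounds apply to one short symmetric interval around
    \<open>x\<close>.\<close>
  have le: "q \<le> p" if q: "x \<notin> slope_below a b f q" and p: "x \<notin> slope_below a b ?g (- p)" for q p
  proof -
    obtain d1 where d1: "d1 > 0"
      "\<And>u v. a < u \<Longrightarrow> u < x \<Longrightarrow> x < v \<Longrightarrow> v < b \<Longrightarrow> v - u < d1 \<Longrightarrow> q * (v - u) \<le> f v - f u"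
      using not_slope_belowD[OF q] by blast
    obtain d2 where d2: "d2 > 0"
      "\<And>u v. a < u \<Longrightarrow> u < x \<Longrightarrow> x < v \<Longrightarrow> v < b \<Longrightarrow> v - u < d2 \<Longrightarrow> - p * (v - u) \<le> - f v - - f u"
      using not_slope_belowD[OF p] by blast
    define h where "h = min (min d1 d2) (min (x - a) (b - x)) / 3"
    have h: "h > 0" "2 * h < d1" "2 * h < d2" "h < x - a" "h < b - x"
      using d1(1) d2(1) x by (auto simp: h_def min_def)
    have "q * (2 * h) \<le> f (x + h) - f (x - h)" "- (p * (2 * h)) \<le> - f (x + h) - - f (x - h)"
      using d1(2)[of "x - h" "x + h"] d2(2)[of "x - h" "x + h"] h by simp_all
    then have "q * (2 * h) \<le> p * (2 * h)" by linarith
    then show "q \<le> p" using h(1) by simp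
  qed
  define S where "S = {q. x \<notin> slope_below a b f q}"
  define D where "D = Sup S"
  have "S \<noteq> {}" using n1 by (auto simp: S_def)
  have bdd: "bdd_above S" using le n2 by (auto simp: S_def intro!: bdd_aboveI[of _ "real n2"])
  have "(f has_real_derivative D) (at x)"
  proof (rule differentiable_if_straddle[OF absolutely_continuous_curve_imp_continuous_on[OF ac] x(1,2)])
    fix e :: real assume "e > 0"
    obtain q where q: "x \<notin> slope_below a b f q" "D - e < q"
      using less_cSupD[OF \<open>S \<noteq> {}\<close>, of "D - e"] \<open>e > 0\<close> unfolding D_def S_def by auto
    \<comment> \<open>The midpoint \<open>D + e / 2\<close> leaves room for rationals with
      \<open>D < q' < p < D + e\<close>. As \<open>q'\<close> exceeds the supremum \<open>D\<close>,
      slopes below \<open>q'\<close> occur at every scale; being off \<open>N3\<close> then excludes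
      slopes above \<open>p\<close> on short intervals.\<close>
    obtain q' where q': "q' \<in> \<rat>" "D < q'" "q' < D + e / 2"
      using Rats_dense_in_real[of D "D + e / 2"] \<open>e > 0\<close> by auto
    obtain p where p: "p \<in> \<rat>" "D + e / 2 < p" "p < D + e"
      using Rats_dense_in_real[of "D + e / 2" "D + e"] \<open>e > 0\<close> by auto
    have "q' \<notin> S" using cSup_upper[OF _ bdd, of q'] q'(2) unfolding D_def by auto
    then have "x \<in> slope_below a b f q'" by (simp add: S_def)
    moreover have "x \<notin> slope_below a b f q' \<inter> slope_below a b ?g (- p)"
      using x(5) q' p unfolding N3_def by force
    ultimately have p': "x \<notin> slope_below a b ?g (- p)" by blast
    obtain d1 where d1: "d1 > 0"
      "\<And>u v. a < u \<Longrightarrow> u < x \<Longrightarrow> x < v \<Longrightarrow> v < b \<Longrightarrow> v - u < d1 \<Longrightarrow> q * (v - u) \<le> f v - f u"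
      using not_slope_belowD[OF q(1)] by blast
    obtain d2 where d2: "d2 > 0"
      "\<And>u v. a < u \<Longrightarrow> u < x \<Longrightarrow> x < v \<Longrightarrow> v < b \<Longrightarrow> v - u < d2 \<Longrightarrow> - p * (v - u) \<le> - f v - - f u"
      using not_slope_belowD[OF p'] by blast
    have "\<bar>f v - f u - D * (v - u)\<bar> \<le> e * (v - u)"
      if "a < u" "u < x" "x < v" "v < b" "v - u < min d1 d2" for u v
    proof -
      have "(D - e) * (v - u) \<le> q * (v - u)" "p * (v - u) \<le> (D + e) * (v - u)"
        using that q p by (auto intro!: mult_right_mono)
      moreover have "q * (v - u) \<le> f v - f u" "- (p * (v - u)) \<le> - f v - - f u"
        using d1(2)[of u v] d2(2)[of u v] that by simp_all
      ultimately have "(D - e) * (v - u) \<le> f v - f u" "f v - f u \<le> (D + e) * (v - u)"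
        by linarith+
      then show ?thesis by (simp add: abs_le_iff algebra_simps)
    qed
    then show "\<exists>d>0. \<forall>u v. a < u \<and> u < x \<and> x < v \<and> v < b \<and> v - u < d \<longrightarrow>
       \<bar>f v - f u - D * (v - u)\<bar> \<le> e * (v - u)"
      using d1(1) d2(1) by (intro exI[of _ "min d1 d2"]) auto
  qed
  then show "a < x \<and> x < b \<and> f differentiable at x"
    using x real_differentiable_def by blast
qed

section \<open>Superlinear convex Hamiltonians\<close>

locale convex_superlinear =
  fixes H :: "real \<Rightarrow> real \<Rightarrow> real"
  assumes cont: "continuous_on ({0..1} \<times> UNIV) (\<lambda>(s, \<mu>). H s \<mu>)"
    and convex: "\<And>s. s \<in> {0..1} \<Longrightarrow> convex_on UNIV (H s)"
    and superlinear: "filterlim (\<lambda>\<mu>. INF s\<in>{0..1}. H s \<mu> / \<bar>\<mu>\<bar>) at_top at_infinity"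
begin

lemma continuous_on_compose_H:
  assumes "continuous_on T g" "continuous_on T h" "\<And>x. x \<in> T \<Longrightarrow> g x \<in> {0..1}"
  shows "continuous_on T (\<lambda>x. H (g x) (h x))"
  using continuous_on_compose2[OF cont continuous_on_Pair[OF assms(1,2)]] assms(3)
  by (simp add: image_subset_iff)

lemma superlinear_lower_bound:
  obtains R where "R \<ge> 1" "\<And>s \<mu>. s \<in> {0..1} \<Longrightarrow> R \<le> \<bar>\<mu>\<bar> \<Longrightarrow> K * \<bar>\<mu>\<bar> \<le> H s \<mu>"
proof -
  have "\<forall>\<^sub>F \<mu> in at_infinity. K \<le> (INF s\<in>{0..1}. H s \<mu> / \<bar>\<mu>\<bar>)"
    using superlinear by (simp add: filterlim_at_top)
  then obtain R where R: "\<And>\<mu>. R \<le> \<bar>\<mu>\<bar> \<Longrightarrow> K \<le> (INF s\<in>{0..1}. H s \<mu> / \<bar>\<mu>\<bar>)"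
    by (auto simp: eventually_at_infinity)
  show ?thesis
  proof
    fix s \<mu> :: real assume s: "s \<in> {0..1}" and \<mu>: "max 1 R \<le> \<bar>\<mu>\<bar>"
    have "continuous_on {0..1} (\<lambda>s. H s \<mu> / \<bar>\<mu>\<bar>)"
      using \<mu> by (intro continuous_intros continuous_on_compose_H) auto
    \<comment> \<open>A real infimum is known to bound its members only when the set is bounded
      below; compactness of \<open>[0, 1]\<close> provides this.\<close>
    then have "bdd_below ((\<lambda>s. H s \<mu> / \<bar>\<mu>\<bar>) ` {0..1})"
      by (intro bounded_imp_bdd_below compact_imp_bounded compact_continuous_image) auto
    then have "(INF s\<in>{0..1}. H s \<mu> / \<bar>\<mu>\<bar>) \<le> H s \<mu> / \<bar>\<mu>\<bar>"
      using s by (rule cINF_lower)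
    with R[of \<mu>] \<mu> have "K \<le> H s \<mu> / \<bar>\<mu>\<bar>" by simp
    then show "K * \<bar>\<mu>\<bar> \<le> H s \<mu>" using \<mu> by (simp add: field_simps)
  qed simp
qed

text \<open>This makes the real \<open>SUP\<close> in the Legendre transform a genuine supremum.
  Superlinearity with constant \<open>|r|\<close> makes the expression nonpositive for large
  \<open>|\<mu>|\<close>, and a compact interval remains.\<close>

lemma bdd_above_Legendre:
  assumes s: "s \<in> {0..1}"
  shows "bdd_above (range (\<lambda>\<mu>. r * \<mu> - H s \<mu>))"
proof -
  obtain R where R: "R \<ge> 1" "\<And>\<mu>. R \<le> \<bar>\<mu>\<bar> \<Longrightarrow> \<bar>r\<bar> * \<bar>\<mu>\<bar> \<le> H s \<mu>"
    using superlinear_lower_bound s by metis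
  have "continuous_on {-R..R} (\<lambda>\<mu>. r * \<mu> - H s \<mu>)"
    using s by (intro continuous_intros continuous_on_compose_H) auto
  then have "bdd_above ((\<lambda>\<mu>. r * \<mu> - H s \<mu>) ` {-R..R})"
    by (intro bounded_imp_bdd_above compact_imp_bounded compact_continuous_image) auto
  then obtain M where M: "\<And>\<mu>. \<mu> \<in> {-R..R} \<Longrightarrow> r * \<mu> - H s \<mu> \<le> M"
    unfolding bdd_above_def by (metis imageI)
  have "r * \<mu> - H s \<mu> \<le> max M 0" for \<mu>
  proof (cases "R \<le> \<bar>\<mu>\<bar>")
    case True
    have "r * \<mu> \<le> \<bar>r\<bar> * \<bar>\<mu>\<bar>" by (simp add: abs_mult[symmetric])
    then show ?thesis using R(2)[OF True] by simp
  next
    case False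
    then have "\<mu> \<in> {-R..R}" by auto
    then show ?thesis using M[of \<mu>] by simp
  qed
  then show ?thesis by (rule bdd_aboveI2)
qed

lemma Legendre_ge: "s \<in> {0..1} \<Longrightarrow> r * \<mu> - H s \<mu> \<le> (SUP \<mu>. r * \<mu> - H s \<mu>)"
  by (rule cSUP_upper[OF _ bdd_above_Legendre]) auto

text \<open>Adding a small multiple of \<open>\<mu>\<^sup>2\<close> makes the minimiser unique, hence continuous in \<open>s\<close>.\<close>

lemma continuous_almost_minimizer:
  assumes "e > 0"
  obtains p where "continuous_on {0..1} p"
    "\<And>s. s \<in> {0..1} \<Longrightarrow> H s (p s) \<le> (SUP s\<in>{0..1}. INF \<mu>. H s \<mu>) + e"
proof -
  have "continuous_on {0..1} (\<lambda>s. H s 0)"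
    by (intro continuous_on_compose_H continuous_intros) auto
  then have "bounded ((\<lambda>s. H s 0) ` {0..1})"
    by (intro compact_imp_bounded compact_continuous_image) auto
  then obtain B where "B > 0" and B: "\<And>s. s \<in> {0..1} \<Longrightarrow> \<bar>H s 0\<bar> \<le> B"
    unfolding bounded_pos by auto
  \<comment> \<open>Outside \<open>[-R, R]\<close> this gives
    \<open>H s \<mu> \<ge> B \<ge> H s 0\<close>, so it suffices to minimise over the compact
    interval.\<close>
  obtain R where R: "R \<ge> 1" "\<And>s \<mu>. s \<in> {0..1} \<Longrightarrow> R \<le> \<bar>\<mu>\<bar> \<Longrightarrow> B * \<bar>\<mu>\<bar> \<le> H s \<mu>"
    using superlinear_lower_bound by metis
  \<comment> \<open>On \<open>[-R, R]\<close> the perturbation \<open>\<eta> * \<mu>\<^sup>2\<close>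
    is then at most \<open>e\<close>.\<close>
  define \<eta> where "\<eta> = e / R\<^sup>2"
  have "\<eta> > 0" using \<open>e > 0\<close> R(1) by (simp add: \<eta>_def)
  define G where "G s \<mu> = H s \<mu> + \<eta> * \<mu>\<^sup>2" for s \<mu>
  \<comment> \<open>All pairs of a parameter and a minimiser of \<open>G\<close> over
    \<open>[-R, R]\<close>. Uniqueness will make \<open>A\<close> the graph of \<open>p\<close>, and
    a closed graph with values in a compact set gives continuity.\<close>
  define A where "A = {z \<in> {0..1} \<times> {-R..R}. \<forall>\<nu>\<in>{-R..R}. G (fst z) (snd z) \<le> G (fst z) \<nu>}"
  have "\<exists>\<mu>. (s, \<mu>) \<in> A" if s: "s \<in> {0..1}" for s
  proof -
    have "continuous_on {-R..R} (G s)"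
      unfolding G_def using s by (intro continuous_intros continuous_on_compose_H) auto
    then obtain \<mu> where "\<mu> \<in> {-R..R}" "\<forall>\<nu>\<in>{-R..R}. G s \<mu> \<le> G s \<nu>"
      using continuous_attains_inf[of "{-R..R}" "G s"] R(1) by auto
    with s show ?thesis by (auto simp: A_def)
  qed
  then obtain p where p: "\<And>s. s \<in> {0..1} \<Longrightarrow> (s, p s) \<in> A" by metis
  have unique: "\<mu> = \<nu>" if "(s, \<mu>) \<in> A" "(s, \<nu>) \<in> A" for s \<mu> \<nu>
  proof (rule ccontr)
    assume "\<mu> \<noteq> \<nu>"
    have s: "s \<in> {0..1}" and mem: "\<mu> \<in> {-R..R}" "\<nu> \<in> {-R..R}" using that by (auto simp: A_def)
    have mid: "(\<mu> + \<nu>) / 2 \<in> {-R..R}" using mem by auto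
    have "H s ((1 - 1/2) *\<^sub>R \<mu> + (1/2) *\<^sub>R \<nu>) \<le> (1 - 1/2) * H s \<mu> + (1/2) * H s \<nu>"
      by (rule convex_onD[OF convex[OF s]]) auto
    then have "H s ((\<mu> + \<nu>) / 2) \<le> (H s \<mu> + H s \<nu>) / 2" by (simp add: add_divide_distrib)
    \<comment> \<open>The parallelogram identity: the midpoint of two distinct minimisers would be
      strictly better than both.\<close>
    moreover have "\<eta> * ((\<mu> + \<nu>) / 2)\<^sup>2 = (\<eta> * \<mu>\<^sup>2 + \<eta> * \<nu>\<^sup>2) / 2 - \<eta> * ((\<mu> - \<nu>) / 2)\<^sup>2"
      by (simp add: power2_eq_square field_simps)
    moreover have "0 < \<eta> * ((\<mu> - \<nu>) / 2)\<^sup>2" using \<open>\<eta> > 0\<close> \<open>\<mu> \<noteq> \<nu>\<close> by simp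
    ultimately have "G s ((\<mu> + \<nu>) / 2) < (G s \<mu> + G s \<nu>) / 2" unfolding G_def by argo
    moreover have "G s \<mu> \<le> G s ((\<mu> + \<nu>) / 2)" "G s \<nu> \<le> G s ((\<mu> + \<nu>) / 2)"
      using that mid by (auto simp: A_def)
    ultimately show False by argo
  qed
  show thesis
  proof
    show "continuous_on {0..1} p"
    proof (rule continuous_from_closed_graph)
      show "compact {-R..R}" by simp
      show "p \<in> {0..1} \<rightarrow> {-R..R}" using p by (auto simp: A_def)
      have "(\<lambda>s. (s, p s)) ` {0..1} = A"
      proof (intro equalityI subsetI)
        fix z assume z: "z \<in> A"
        then have "fst z \<in> {0..1}" by (auto simp: A_def)
        moreover from this have "snd z = p (fst z)"
          using unique[of "fst z" "snd z" "p (fst z)"] p z by simp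
        ultimately show "z \<in> (\<lambda>s. (s, p s)) ` {0..1}"
          by (intro image_eqI[of _ _ "fst z"]) (auto simp: prod_eq_iff)
      qed (use p in auto)
      \<comment> \<open>The index set contains 1 because \<open>R \<ge> 1\<close>; it has to be
        nonempty for the intersection to lie in the box.\<close>
      also have "A = (\<Inter>\<nu>\<in>{-R..R}. {z \<in> {0..1} \<times> {-R..R}. G (fst z) (snd z) \<le> G (fst z) \<nu>})"
        using R(1) by (fastforce simp: A_def intro: exI[of _ 1])
      also have "closed \<dots>"
        unfolding G_def
        by (intro closed_INT ballI continuous_on_closed_Collect_le closed_Times continuous_intros
            continuous_on_compose_H) auto
      finally show "closed ((\<lambda>s. (s, p s)) ` {0..1})" .
    qed
    fix s :: real assume s: "s \<in> {0..1}"
    have ps: "p s \<in> {-R..R}" "\<And>\<nu>. \<nu> \<in> {-R..R} \<Longrightarrow> G s (p s) \<le> G s \<nu>"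
      using p[OF s] by (auto simp: A_def)
    have le_G: "H s (p s) \<le> G s (p s)" using \<open>\<eta> > 0\<close> by (simp add: G_def)
    have almost: "H s (p s) - e \<le> H s \<mu>" for \<mu>
    proof (cases "R \<le> \<bar>\<mu>\<bar>")
      case True
      have "H s (p s) \<le> G s 0" using le_G ps(2)[of 0] R(1) by simp
      also have "\<dots> \<le> B * 1" using B[OF s] by (simp add: G_def)
      also have "\<dots> \<le> B * \<bar>\<mu>\<bar>" using True R(1) \<open>B > 0\<close> by (intro mult_left_mono) auto
      also have "\<dots> \<le> H s \<mu>" by (rule R(2)[OF s True])
      finally show ?thesis using \<open>e > 0\<close> by simp
    next
      case False
      have "\<mu>\<^sup>2 \<le> R\<^sup>2" using False by (simp add: abs_le_square_iff[symmetric])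
      then have "\<eta> * \<mu>\<^sup>2 \<le> \<eta> * R\<^sup>2" using \<open>\<eta> > 0\<close> by (intro mult_left_mono) auto
      also have "\<dots> = e" using R(1) by (simp add: \<eta>_def)
      finally have "\<eta> * \<mu>\<^sup>2 \<le> e" .
      moreover have "\<mu> \<in> {-R..R}" using False by auto
      ultimately show ?thesis using le_G ps(2)[of \<mu>] by (simp add: G_def)
    qed
    then have "H s (p s) - e \<le> (INF \<mu>. H s \<mu>)" by (intro cINF_greatest) auto
    also have "\<dots> \<le> (SUP s\<in>{0..1}. INF \<mu>. H s \<mu>)"
    proof (rule cSUP_upper[OF s])
      have "(INF \<mu>. H t \<mu>) \<le> B" if t: "t \<in> {0..1}" for t
      proof -
        have "bdd_below (range (H t))"
        proof -
          have "bdd_above (range (\<lambda>\<mu>. 0 * \<mu> - H t \<mu>))" by (rule bdd_above_Legendre[OF t])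
          then show ?thesis by (auto simp: bdd_above_def bdd_below_def) (metis minus_le_iff)
        qed
        then have "(INF \<mu>. H t \<mu>) \<le> H t 0" by (rule cINF_lower) simp
        with B[OF t] show ?thesis by simp
      qed
      then show "bdd_above ((\<lambda>s. INF \<mu>. H s \<mu>) ` {0..1})" by (rule bdd_aboveI2)
    qed
    finally show "H s (p s) \<le> (SUP s\<in>{0..1}. INF \<mu>. H s \<mu>) + e" by simp
  qed
qed

text \<open>Continuity in \<open>\<mu>\<close> makes rational \<open>\<mu>\<close> sufficient.
  Superlevel sets of the Legendre transform along a curve thus become countable unions, which gives
  measurability.\<close>

lemma less_Legendre_iff_rational:
  assumes s: "s \<in> {0..1}"
  shows "y < (SUP \<mu>. r * \<mu> - H s \<mu>) \<longleftrightarrow> (\<exists>\<mu>\<in>\<rat>. y < r * \<mu> - H s \<mu>)"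
proof
  assume "y < (SUP \<mu>. r * \<mu> - H s \<mu>)"
  then obtain \<nu> where \<nu>: "y < r * \<nu> - H s \<nu>"
    using less_cSUP_iff[OF _ bdd_above_Legendre[OF s]] by auto
  have "continuous_on UNIV (\<lambda>\<mu>. r * \<mu> - H s \<mu>)"
    using s by (intro continuous_intros continuous_on_compose_H) auto
  then have "open {\<mu>. y < r * \<mu> - H s \<mu>}"
    by (intro open_Collect_less continuous_on_const)
  then obtain e where e: "e > 0" "ball \<nu> e \<subseteq> {\<mu>. y < r * \<mu> - H s \<mu>}"
    using \<nu> by (auto simp: open_contains_ball)
  obtain \<mu> where "\<mu> \<in> \<rat>" "\<nu> < \<mu>" "\<mu> < \<nu> + e"
    using Rats_dense_in_real[of \<nu> "\<nu> + e"] e(1) by auto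
  moreover from this have "\<mu> \<in> ball \<nu> e" by (simp add: dist_real_def)
  ultimately show "\<exists>\<mu>\<in>\<rat>. y < r * \<mu> - H s \<mu>" using e(2) by blast
next
  assume "\<exists>\<mu>\<in>\<rat>. y < r * \<mu> - H s \<mu>"
  then show "y < (SUP \<mu>. r * \<mu> - H s \<mu>)"
    using Legendre_ge[OF s] less_le_trans by blast
qed

text \<open>Testing with \<open>\<mu> = 0\<close> bounds the transform uniformly in \<open>s\<close>
  and \<open>r\<close>; the negative part of the Lagrangian along the curve is therefore
  integrable.\<close>

lemma Legendre_lower_bound:
  obtains C where "\<And>s r. s \<in> {0..1} \<Longrightarrow> - C \<le> (SUP \<mu>. r * \<mu> - H s \<mu>)"
proof -
  have "continuous_on {0..1} (\<lambda>s. H s 0)"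
    by (intro continuous_on_compose_H continuous_intros) auto
  then have "bdd_above ((\<lambda>s. H s 0) ` {0..1})"
    by (intro bounded_imp_bdd_above compact_imp_bounded compact_continuous_image) auto
  then obtain C where C: "\<And>s. s \<in> {0..1} \<Longrightarrow> H s 0 \<le> C"
    unfolding bdd_above_def by (metis imageI)
  show thesis
  proof
    fix s r :: real assume s: "s \<in> {0..1}"
    show "- C \<le> (SUP \<mu>. r * \<mu> - H s \<mu>)"
      using Legendre_ge[OF s, of r 0] C[OF s] by simp
  qed
qed

lemma borel_measurable_Legendre:
  fixes a b :: real
  assumes s: "continuous_on {a..b} s" "\<And>t. t \<in> {a..b} \<Longrightarrow> s t \<in> {0..1}"
    and D: "D \<in> borel_measurable (lebesgue_on {a..b})"
  shows "(\<lambda>t. SUP \<mu>. D t * \<mu> - H (s t) \<mu>) \<in> borel_measurable (lebesgue_on {a..b})"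
  unfolding borel_measurable_iff_greater
proof
  fix y :: real
  have eq: "{t \<in> space (lebesgue_on {a..b}). y < (SUP \<mu>. D t * \<mu> - H (s t) \<mu>)} =
        (\<Union>\<mu>\<in>\<rat>. {t \<in> space (lebesgue_on {a..b}). y < D t * \<mu> - H (s t) \<mu>})"
    using less_Legendre_iff_rational s(2) by auto
  have "(\<lambda>t. H (s t) \<mu>) \<in> borel_measurable (lebesgue_on {a..b})" for \<mu>
    using s by (intro continuous_imp_measurable_on_sets_lebesgue continuous_on_compose_H continuous_intros) auto
  then show "{t \<in> space (lebesgue_on {a..b}). y < (SUP \<mu>. D t * \<mu> - H (s t) \<mu>)} \<in> sets (lebesgue_on {a..b})"
    unfolding eq using D
    by (intro sets.countable_UN'' countable_rat borel_measurable_less borel_measurable_diff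
        borel_measurable_times borel_measurable_const) auto
qed

end

section \<open>Arcs of a network\<close>

lemma velocity_eqI:
  assumes "s \<in> {0..1}" "(\<gamma> has_vector_derivative v) (at s within {0..1})"
  shows "velocity \<gamma> s = v"
  unfolding velocity_def using vector_derivative_within_cbox[of 0 1 s \<gamma> v] assms by simp

lemma regular_curve_has_vector_derivative:
  assumes "regular_curve \<gamma>" "s \<in> {0..1}"
  shows "(\<gamma> has_vector_derivative velocity \<gamma> s) (at s within {0..1})"
  using assms unfolding regular_curve_def velocity_def differentiable_on_def
  by (simp add: vector_derivative_works[symmetric])

lemma inverse_arc_apply: "s \<in> {0..1} \<Longrightarrow> inverse_arc \<gamma> s = \<gamma> (1 - s)"
  by (simp add: inverse_arc_def reversepath_def)

lemma inverse_arc_image: "inverse_arc \<gamma> ` {0..1} = \<gamma> ` {0..1}"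
proof -
  have "inverse_arc \<gamma> ` {0..1} = \<gamma> ` (\<lambda>s. 1 - s) ` {0..1}"
    unfolding image_image by (intro image_cong refl inverse_arc_apply)
  then show ?thesis by simp
qed

lemma inverse_arc_has_vector_derivative:
  assumes "(\<gamma> has_vector_derivative v) (at (1 - s) within {0..1})" "s \<in> {0..1}"
  shows "(inverse_arc \<gamma> has_vector_derivative - v) (at s within {0..1})"
proof (rule has_vector_derivative_transform[OF assms(2)])
  have "((\<lambda>s. 1 - s) has_vector_derivative -1) (at s within {0..1})"
    by (auto intro!: derivative_eq_intros)
  moreover have "(\<gamma> has_vector_derivative v) (at (1 - s) within (\<lambda>s. 1 - s) ` {0..1})"
    using assms(1) by simp
  ultimately have "(\<gamma> \<circ> (\<lambda>s. 1 - s) has_vector_derivative -1 *\<^sub>R v) (at s within {0..1})"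
    by (rule vector_diff_chain_within)
  then show "(\<gamma> \<circ> (\<lambda>s. 1 - s) has_vector_derivative - v) (at s within {0..1})" by simp
qed (simp add: inverse_arc_apply)

lemma simple_path_imp_inj_on:
  assumes "simple_path \<gamma>" "\<gamma> 0 \<noteq> \<gamma> 1"
  shows "inj_on \<gamma> {0..1}"
proof (rule inj_onI)
  fix s t :: real assume "s \<in> {0..1}" "t \<in> {0..1}" "\<gamma> s = \<gamma> t"
  then have "s = t \<or> s = 0 \<and> t = 1 \<or> s = 1 \<and> t = 0"
    using assms(1) unfolding simple_path_def loop_free_def by blast
  then show "s = t" using \<open>\<gamma> s = \<gamma> t\<close> assms(2) by auto
qed

locale arc_network =
  fixes E :: "(real \<Rightarrow> real ^ 'n::finite) set"
  assumes network: "network E"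
begin

lemma finite_arcs: "finite (arcs E)"
  using network by (simp add: network_def arcs_def)

lemma arc_inj_on: "\<gamma> \<in> arcs E \<Longrightarrow> inj_on \<gamma> {0..1}"
proof -
  have E: "inj_on \<gamma> {0..1}" if "\<gamma> \<in> E" for \<gamma>
    using that network unfolding network_def
    by (intro simple_path_imp_inj_on) (auto simp: regular_curve_def arcs_def)
  assume "\<gamma> \<in> arcs E"
  then consider "\<gamma> \<in> E" | \<gamma>' where "\<gamma>' \<in> E" "\<gamma> = inverse_arc \<gamma>'"
    by (auto simp: arcs_def)
  then show ?thesis
  proof cases
    case (2 \<gamma>')
    show ?thesis
    proof (rule inj_onI)
      fix s t :: real assume st: "s \<in> {0..1}" "t \<in> {0..1}" "\<gamma> s = \<gamma> t"
      then have "\<gamma>' (1 - s) = \<gamma>' (1 - t)" by (simp add: 2 inverse_arc_apply)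
      then have "1 - s = 1 - t" using st by (intro inj_onD[OF E[OF 2(1)]]) auto
      then show "s = t" by simp
    qed
  qed (rule E)
qed

lemma arc_image_subset: "\<gamma> \<in> arcs E \<Longrightarrow> \<gamma> ` {0..1} \<subseteq> network_set E"
  unfolding arcs_def network_set_def using inverse_arc_image by blast

lemma arc_has_vector_derivative:
  assumes "\<gamma> \<in> arcs E" "s \<in> {0..1}"
  shows "(\<gamma> has_vector_derivative velocity \<gamma> s) (at s within {0..1})"
proof -
  consider "\<gamma> \<in> E" | \<gamma>' where "\<gamma>' \<in> E" "\<gamma> = inverse_arc \<gamma>'"
    using assms(1) by (auto simp: arcs_def)
  then show ?thesis
  proof cases
    case 1
    then show ?thesis
      using network assms(2) by (simp add: network_def regular_curve_has_vector_derivative)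
  next
    case (2 \<gamma>')
    have "(\<gamma>' has_vector_derivative velocity \<gamma>' (1 - s)) (at (1 - s) within {0..1})"
      using network assms(2) 2(1) by (simp add: network_def regular_curve_has_vector_derivative)
    note d = inverse_arc_has_vector_derivative[OF this assms(2)]
    show ?thesis unfolding 2(2) velocity_eqI[OF assms(2) d] by (rule d)
  qed
qed

lemma velocity_inverse_arc:
  assumes "\<gamma> \<in> arcs E" "s \<in> {0..1}"
  shows "velocity (inverse_arc \<gamma>) s = - velocity \<gamma> (1 - s)"
  by (intro velocity_eqI inverse_arc_has_vector_derivative arc_has_vector_derivative) (use assms in auto)

lemma velocity_continuous_nonzero:
  assumes "\<gamma> \<in> arcs E"
  shows "continuous_on {0..1} (velocity \<gamma>)" "s \<in> {0..1} \<Longrightarrow> velocity \<gamma> s \<noteq> 0"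
proof -
  have "continuous_on {0..1} (velocity \<gamma>) \<and> (\<forall>s\<in>{0..1}. velocity \<gamma> s \<noteq> 0)"
  proof -
    consider "\<gamma> \<in> E" | \<gamma>' where "\<gamma>' \<in> E" "\<gamma> = inverse_arc \<gamma>'"
      using assms by (auto simp: arcs_def)
    then show ?thesis
    proof cases
      case 1
      then show ?thesis using network by (simp add: network_def regular_curve_def)
    next
      case (2 \<gamma>')
      have \<gamma>': "\<gamma>' \<in> arcs E" "regular_curve \<gamma>'"
        using 2(1) network by (simp_all add: arcs_def network_def)
      have v: "velocity \<gamma> s = - velocity \<gamma>' (1 - s)" if "s \<in> {0..1}" for s
        using velocity_inverse_arc[OF \<gamma>'(1) that] 2(2) by simp
      have "continuous_on {0..1} (velocity \<gamma>')"
        using \<gamma>'(2) by (simp add: regular_curve_def)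
      then have "continuous_on {0..1} (\<lambda>s. velocity \<gamma>' (1 - s))"
        by (rule continuous_on_compose2) (auto intro!: continuous_intros)
      then have "continuous_on {0..1} (\<lambda>s. - velocity \<gamma>' (1 - s))"
        by (rule continuous_on_minus)
      then have "continuous_on {0..1} (velocity \<gamma>)"
        by (rule continuous_on_eq) (simp add: v)
      then show ?thesis
        using \<gamma>'(2) v unfolding regular_curve_def by auto
    qed
  qed
  then show "continuous_on {0..1} (velocity \<gamma>)" "s \<in> {0..1} \<Longrightarrow> velocity \<gamma> s \<noteq> 0" by blast+
qed

lemma arc_continuous_on: "\<gamma> \<in> arcs E \<Longrightarrow> continuous_on {0..1} \<gamma>"
  using arc_has_vector_derivative
  by (meson continuous_on_eq_continuous_within has_vector_derivative_continuous)

text \<open>Let \<open>m\<close> be the minimal speed. For nearby parameters the velocity varies by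
  less than \<open>m / 2\<close>, so the chord has length at least \<open>m / 2\<close> times the
  parameter difference. For parameters at distance at least \<open>\<delta>\<close>, injectivity and
  compactness bound the chord below by some \<open>m' > 0\<close>.\<close>

lemma arc_inverse_Lipschitz:
  assumes \<gamma>: "\<gamma> \<in> arcs E"
  obtains K where "K > 0" "\<And>s t. s \<in> {0..1} \<Longrightarrow> t \<in> {0..1} \<Longrightarrow> \<bar>s - t\<bar> \<le> K * norm (\<gamma> s - \<gamma> t)"
proof -
  note V = velocity_continuous_nonzero[OF \<gamma>]
  have "continuous_on {0..1} (\<lambda>s. norm (velocity \<gamma> s))"
    using V(1) by (intro continuous_intros)
  then obtain s0 where s0: "s0 \<in> {0..1}" "\<And>s. s \<in> {0..1} \<Longrightarrow> norm (velocity \<gamma> s0) \<le> norm (velocity \<gamma> s)"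
    using continuous_attains_inf[of "{0..1}" "\<lambda>s. norm (velocity \<gamma> s)"] by auto
  define m where "m = norm (velocity \<gamma> s0)"
  have "m > 0" using V(2)[OF s0(1)] by (simp add: m_def)
  have "uniformly_continuous_on {0..1} (velocity \<gamma>)"
    using V(1) by (intro compact_uniformly_continuous) auto
  then obtain \<delta> where "\<delta> > 0" and \<delta>:
    "\<And>s t. s \<in> {0..1} \<Longrightarrow> t \<in> {0..1} \<Longrightarrow> dist t s < \<delta> \<Longrightarrow> dist (velocity \<gamma> t) (velocity \<gamma> s) < m / 2"
    unfolding uniformly_continuous_on_def using \<open>m > 0\<close> half_gt_zero by metis
  have near: "\<bar>s - t\<bar> \<le> 2 / m * norm (\<gamma> s - \<gamma> t)" if st: "s \<in> {0..1}" "t \<in> {0..1}" "\<bar>s - t\<bar> < \<delta>" for s t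
  proof -
    have sub: "closed_segment t s \<subseteq> {0..1}"
      using st by (auto simp: closed_segment_eq_real_ivl split: if_splits)
    have "norm (\<gamma> s - \<gamma> t - (s - t) *\<^sub>R velocity \<gamma> t) \<le> norm (s - t) * (m / 2)"
    proof (rule vector_differentiable_bound_linearization[of "closed_segment t s" \<gamma> "velocity \<gamma>"])
      fix y assume y: "y \<in> closed_segment t s"
      show "(\<gamma> has_vector_derivative velocity \<gamma> y) (at y within closed_segment t s)"
        using arc_has_vector_derivative[OF \<gamma>] sub y by (meson has_vector_derivative_within_subset subsetD)
      have "dist y t < \<delta>"
        using y st(3) by (auto simp: closed_segment_eq_real_ivl dist_real_def split: if_splits)
      then show "norm (velocity \<gamma> y - velocity \<gamma> t) \<le> m / 2"
        using \<delta>[of t y] sub y st by (auto simp: dist_norm)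
    qed auto
    moreover have "m * \<bar>s - t\<bar> \<le> norm ((s - t) *\<^sub>R velocity \<gamma> t)"
      using s0(2)[OF st(2)] by (simp add: m_def mult.commute mult_left_mono)
    moreover have "norm ((s - t) *\<^sub>R velocity \<gamma> t) - norm (\<gamma> s - \<gamma> t)
        \<le> norm (\<gamma> s - \<gamma> t - (s - t) *\<^sub>R velocity \<gamma> t)"
      by (metis norm_minus_commute norm_triangle_ineq2)
    ultimately have "m * \<bar>s - t\<bar> \<le> 2 * norm (\<gamma> s - \<gamma> t)" by (simp add: field_simps)
    then show ?thesis using \<open>m > 0\<close> by (simp add: field_simps)
  qed
  define T where "T = {z \<in> {0..1} \<times> {0..1}. \<delta> \<le> \<bar>fst z - snd z\<bar>}"
  have "compact T"
    unfolding T_def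
    by (rule compact_Int_closed[of "{0..1} \<times> {0..1}" "{z. \<delta> \<le> \<bar>fst z - snd z\<bar>}", unfolded Int_def mem_Collect_eq])
      (auto intro!: compact_Times closed_Collect_le continuous_intros)
  obtain m' where "m' > 0" and m': "\<And>z. z \<in> T \<Longrightarrow> m' \<le> norm (\<gamma> (fst z) - \<gamma> (snd z))"
  proof (cases "T = {}")
    case True
    then show ?thesis using that[of 1] by simp
  next
    case False
    have "continuous_on T (\<lambda>z. norm (\<gamma> (fst z) - \<gamma> (snd z)))"
      by (intro continuous_intros continuous_on_compose2[OF arc_continuous_on[OF \<gamma>]]) (auto simp: T_def)
    then obtain z0 where z0: "z0 \<in> T" "\<And>z. z \<in> T \<Longrightarrow> norm (\<gamma> (fst z0) - \<gamma> (snd z0)) \<le> norm (\<gamma> (fst z) - \<gamma> (snd z))"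
      using continuous_attains_inf[OF \<open>compact T\<close> False, of "\<lambda>z. norm (\<gamma> (fst z) - \<gamma> (snd z))"] by auto
    have "\<gamma> (fst z0) \<noteq> \<gamma> (snd z0)"
      using z0(1) \<open>\<delta> > 0\<close> inj_onD[OF arc_inj_on[OF \<gamma>], of "fst z0" "snd z0"] by (auto simp: T_def)
    with z0(2) show ?thesis by (intro that[of "norm (\<gamma> (fst z0) - \<gamma> (snd z0))"]) auto
  qed
  show thesis
  proof
    \<comment> \<open>The sum of the two constants dominates each of them, so it serves both
      regimes.\<close>
    show "2 / m + 1 / m' > 0" using \<open>m > 0\<close> \<open>m' > 0\<close> by (simp add: add_pos_pos)
    fix s t :: real assume st: "s \<in> {0..1}" "t \<in> {0..1}"
    have "\<bar>s - t\<bar> \<le> 2 / m * norm (\<gamma> s - \<gamma> t) \<or> \<bar>s - t\<bar> \<le> 1 / m' * norm (\<gamma> s - \<gamma> t)"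
    proof (cases "\<bar>s - t\<bar> < \<delta>")
      case True
      then show ?thesis using near st by blast
    next
      case False
      then have "m' \<le> norm (\<gamma> s - \<gamma> t)" using m'[of "(s,t)"] st by (simp add: T_def)
      then have "1 \<le> 1 / m' * norm (\<gamma> s - \<gamma> t)" using \<open>m' > 0\<close> by (simp add: field_simps)
      moreover have "\<bar>s - t\<bar> \<le> 1" using st by auto
      ultimately show ?thesis by linarith
    qed
    moreover have "0 \<le> 2 / m * norm (\<gamma> s - \<gamma> t)" "0 \<le> 1 / m' * norm (\<gamma> s - \<gamma> t)"
      using \<open>m > 0\<close> \<open>m' > 0\<close> by simp_all
    ultimately show "\<bar>s - t\<bar> \<le> (2 / m + 1 / m') * norm (\<gamma> s - \<gamma> t)"
      unfolding distrib_right by linarith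
  qed
qed

lemma arc_through_interior_point:
  assumes "\<gamma> \<in> arcs E" "\<gamma>' \<in> arcs E" "s \<in> {0..1}" "\<gamma> s \<in> \<gamma>' ` {0<..<1}"
  shows "\<gamma>' = \<gamma> \<or> \<gamma>' = inverse_arc \<gamma>"
proof (rule ccontr)
  assume "\<not> ?thesis"
  then have "\<gamma>' ` {0<..<1} \<inter> \<gamma> ` {0..1} = {}"
    using network assms(1,2) unfolding network_def by blast
  then show False using assms(3,4) by blast
qed

section \<open>The overall Lagrangian along an arc\<close>

lemma scaled_velocity_in_tangent_bundle:
  assumes "\<gamma> \<in> arcs E" "s \<in> {0..1}"
  shows "(\<gamma> s, r *\<^sub>R velocity \<gamma> s) \<in> tangent_bundle E"
  using assms arc_image_subset unfolding tangent_bundle_def by blast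

lemma overall_lagrangian_vertex:
  assumes "\<gamma> \<in> arcs E"
  shows "overall_lagrangian E H c (\<gamma> 1) 0 = ereal (c (\<gamma> 1))"
proof -
  have "(\<gamma> 1, 0) \<in> tangent_bundle E"
    using scaled_velocity_in_tangent_bundle[OF assms, of 1 0] by simp
  moreover have "\<gamma> 1 \<in> vertices E" using assms by (auto simp: vertices_def)
  ultimately show ?thesis by (simp add: overall_lagrangian_def)
qed

text \<open>Reversal replaces \<open>\<mu>\<close> by \<open>- \<mu>\<close> in the Hamiltonian and
  \<open>r\<close> by \<open>- r\<close>; the supremum then runs over the same set of
  values.\<close>

lemma arc_lagrangian_inverse_arc:
  assumes "hamiltonians E H" "\<gamma> \<in> arcs E" "s \<in> {0..1}"
  shows "arc_lagrangian H (inverse_arc \<gamma>) (1 - s) (- r) = arc_lagrangian H \<gamma> s r"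
proof -
  have eq: "- r * \<mu> - H (inverse_arc \<gamma>) (1 - s) \<mu> = r * - \<mu> - H \<gamma> s (- \<mu>)" for \<mu>
    using assms by (simp add: hamiltonians_def)
  then have "range (\<lambda>\<mu>. - r * \<mu> - H (inverse_arc \<gamma>) (1 - s) \<mu>) = (\<lambda>\<mu>. r * \<mu> - H \<gamma> s \<mu>) ` range uminus"
    by (simp only: eq image_image)
  then show ?thesis
    unfolding arc_lagrangian_def by (simp add: surj_uminus)
qed

text \<open>At such a point \<open>SOME\<close> may return \<open>\<gamma>\<close> or its inverse.
  In the second case the parameter is \<open>1 - s\<close> and the velocity is reversed, so the
  coefficient becomes \<open>- r\<close>, and the symmetry of the Lagrangians gives the same
  value.\<close>

lemma overall_lagrangian_arc:
  assumes H: "hamiltonians E H" and \<gamma>: "\<gamma> \<in> arcs E" and s: "0 < s" "s < 1" and "\<gamma> s \<notin> vertices E"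
  shows "overall_lagrangian E H c (\<gamma> s) (r *\<^sub>R velocity \<gamma> s) = ereal (arc_lagrangian H \<gamma> s r)"
proof -
  have s01: "s \<in> {0..1}" "1 - s \<in> {0..1}" using s by auto
  define \<gamma>' where "\<gamma>' = (SOME \<gamma>'. \<gamma>' \<in> arcs E \<and> \<gamma> s \<in> \<gamma>' ` {0<..<1})"
  have "\<gamma>' \<in> arcs E \<and> \<gamma> s \<in> \<gamma>' ` {0<..<1}"
    unfolding \<gamma>'_def by (rule someI[of _ \<gamma>]) (use \<gamma> s in auto)
  then have \<gamma>': "\<gamma>' \<in> arcs E" "\<gamma>' = \<gamma> \<or> \<gamma>' = inverse_arc \<gamma>"
    using arc_through_interior_point[OF \<gamma>] s01 by blast+
  define s' where "s' = inv_into {0..1} \<gamma>' (\<gamma> s)"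
  have v0: "velocity \<gamma> s \<noteq> 0" by (rule velocity_continuous_nonzero(2)[OF \<gamma> s01(1)])
  have "arc_lagrangian H \<gamma>' s' ((r *\<^sub>R velocity \<gamma> s \<bullet> velocity \<gamma>' s') / (norm (velocity \<gamma>' s'))\<^sup>2) = arc_lagrangian H \<gamma> s r"
    using \<gamma>'(2)
  proof
    assume eq: "\<gamma>' = \<gamma>"
    then have "s' = s" unfolding s'_def using inv_into_f_f[OF arc_inj_on[OF \<gamma>] s01(1)] by simp
    then show ?thesis using v0 eq by (simp add: power2_norm_eq_inner)
  next
    assume eq: "\<gamma>' = inverse_arc \<gamma>"
    have "\<gamma> s = inverse_arc \<gamma> (1 - s)" using s01 by (simp add: inverse_arc_apply)
    then have s': "s' = 1 - s"
      unfolding s'_def eq using inv_into_f_f[OF arc_inj_on[OF \<gamma>'(1)[unfolded eq]] s01(2)] by simp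
    have "velocity \<gamma>' s' = - velocity \<gamma> s"
      unfolding eq s' using velocity_inverse_arc[OF \<gamma> s01(2)] by simp
    then have "(r *\<^sub>R velocity \<gamma> s \<bullet> velocity \<gamma>' s') / (norm (velocity \<gamma>' s'))\<^sup>2 = - r"
      using v0 by (simp add: power2_norm_eq_inner)
    then show ?thesis unfolding eq s' using arc_lagrangian_inverse_arc[OF H \<gamma> s01(1)] by simp
  qed
  then show ?thesis
    using scaled_velocity_in_tangent_bundle[OF \<gamma> s01(1)] assms(5)
    unfolding overall_lagrangian_def Let_def \<gamma>'_def[symmetric] s'_def[symmetric] by simp
qed

end

section \<open>The action of a closed curve near a vertex\<close>

text \<open>Completeness of Lebesgue measure: whatever \<open>g\<close> does on \<open>N\<close>,
  its preimages meet \<open>N\<close> in null sets, which are measurable. The Lagrangian along the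
  curve is only identified off such a set.\<close>

lemma borel_measurable_lebesgue_on_spike:
  assumes S: "S \<in> sets lebesgue" and N: "negligible N" and f: "f \<in> borel_measurable (lebesgue_on S)"
    and eq: "\<And>x. x \<in> S - N \<Longrightarrow> g x = f x"
  shows "g \<in> borel_measurable (lebesgue_on S)"
proof (rule measurableI)
  fix A :: "'b set" assume "A \<in> sets borel"
  then have "f -` A \<inter> S \<in> sets lebesgue"
    using measurable_sets[OF f] S by (simp add: sets_restrict_space_iff)
  moreover have "N \<in> sets lebesgue" "g -` A \<inter> S \<inter> N \<in> sets lebesgue"
    using N by (auto intro: negligible_imp_sets negligible_subset)
  moreover have "g -` A \<inter> S = (f -` A \<inter> S - N) \<union> (g -` A \<inter> S \<inter> N)"
    using eq by auto
  ultimately have "g -` A \<inter> S \<in> sets lebesgue" by (metis sets.Diff sets.Un)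
  then show "g -` A \<inter> space (lebesgue_on S) \<in> sets (lebesgue_on S)"
    using S by (simp add: sets_restrict_space_iff)
qed simp

text \<open>Since \<open>g\<close> is merely gauge integrable, the comparison must take place
  between gauge integrals. The lower bound on \<open>f\<close> makes its negative part finite; if
  the positive part is finite too, \<open>f\<close> is Lebesgue integrable and hence gauge
  integrable with the same value.\<close>

lemma extended_integral_ge:
  fixes f g :: "real \<Rightarrow> real" and F :: "real \<Rightarrow> ereal"
  assumes f: "f \<in> borel_measurable (lebesgue_on {a..b})" and N: "negligible N"
    and F: "\<And>t. t \<in> {a..b} - N \<Longrightarrow> F t = ereal (f t)"
    and lower: "\<And>t. t \<in> {a..b} \<Longrightarrow> - C \<le> f t"
    and g: "(g has_integral I) {a..b}" and le: "\<And>t. t \<in> {a..b} \<Longrightarrow> g t \<le> f t"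
  shows "ereal I \<le> extended_integral (lebesgue_on {a..b}) F"
proof -
  define M where "M = lebesgue_on {a..b}"
  have fM: "f \<in> borel_measurable M" using f by (simp add: M_def)
  have FM: "F \<in> borel_measurable M"
    unfolding M_def
    by (rule borel_measurable_lebesgue_on_spike[OF _ N, of _ "\<lambda>t. ereal (f t)"]) (use f F in auto)
  have "AE t in lebesgue. t \<notin> N"
    using N by (intro AE_not_in) (simp add: negligible_iff_null_sets)
  then have ae: "AE t in M. F t = ereal (f t)"
    unfolding M_def by (subst AE_restrict_space_iff) (auto elim!: eventually_mono simp: F)
  have neg: "(\<integral>\<^sup>+ t. e2ennreal (- F t) \<partial>M) = (\<integral>\<^sup>+ t. ennreal (- f t) \<partial>M)"
    by (rule nn_integral_cong_AE) (use ae in \<open>eventually_elim, simp\<close>)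
  have pos: "(\<integral>\<^sup>+ t. e2ennreal (F t) \<partial>M) = (\<integral>\<^sup>+ t. ennreal (f t) \<partial>M)"
    by (rule nn_integral_cong_AE) (use ae in \<open>eventually_elim, simp\<close>)
  have "(\<integral>\<^sup>+ t. ennreal (- f t) \<partial>M) \<le> (\<integral>\<^sup>+ t. ennreal C \<partial>M)"
    using lower by (intro nn_integral_mono ennreal_leI) (force simp: M_def)
  also have "\<dots> = ennreal C * emeasure lebesgue {a..b}"
    by (simp add: M_def emeasure_restrict_space)
  also have "\<dots> < \<infinity>"
    by (simp add: ennreal_mult_less_top emeasure_lborel_Icc_eq)
  finally have fin: "(\<integral>\<^sup>+ t. ennreal (- f t) \<partial>M) < \<infinity>" .
  have ext: "extended_integral M F =
      enn2ereal (\<integral>\<^sup>+ t. ennreal (f t) \<partial>M) - enn2ereal (\<integral>\<^sup>+ t. ennreal (- f t) \<partial>M)"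
    using FM fin by (simp add: extended_integral_def neg pos)
  show ?thesis
  proof (cases "(\<integral>\<^sup>+ t. ennreal (f t) \<partial>M) = \<infinity>")
    case True
    have "enn2ereal (\<integral>\<^sup>+ t. ennreal (- f t) \<partial>M) \<noteq> \<infinity>" using fin by auto
    then show ?thesis using ext True unfolding M_def[symmetric] by simp
  next
    case False
    then have int: "integrable M f"
      using fin fM by (simp add: real_integrable_def)
    then obtain r q where rq: "0 \<le> r" "0 \<le> q" "(\<integral>\<^sup>+ t. ennreal (f t) \<partial>M) = ennreal r"
      "(\<integral>\<^sup>+ t. ennreal (- f t) \<partial>M) = ennreal q" "integral\<^sup>L M f = r - q"
      by (rule integrableE)
    have "(f has_integral (r - q)) {a..b}"
      using has_integral_integral_lebesgue_on[of "{a..b}" f] int rq(5) by (simp add: M_def)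
    then have "I \<le> r - q" using g le by (intro has_integral_le[of g I "{a..b}" f]) auto
    then show ?thesis using ext rq unfolding M_def[symmetric] by simp
  qed
qed

text \<open>As \<open>p\<close> is bounded, its primitive \<open>P\<close> is Lipschitz and
  \<open>P \<circ> s\<close> is absolutely continuous. The integral is the increment of
  \<open>P \<circ> s\<close>, which vanishes because \<open>s\<close> ends where it starts.\<close>

lemma absolutely_continuous_chain_rule_integral:
  assumes ac: "absolutely_continuous_curve a b s" and "a \<le> b"
    and s: "\<And>t. t \<in> {a..b} \<Longrightarrow> s t \<in> {0..1}" and N: "negligible N"
    and D: "\<And>t. t \<in> {a..b} - N \<Longrightarrow> (s has_real_derivative D t) (at t within {a..b})"
    and p: "continuous_on {0..1} p" and "s a = s b"
  shows "((\<lambda>t. p (s t) * D t) has_integral 0) {a..b}"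
proof -
  define P where "P u = integral {0..u} p" for u
  have P: "(P has_real_derivative p u) (at u within {0..1})" if "u \<in> {0..1}" for u
    unfolding P_def using integral_has_real_derivative[OF p that] .
  have "bounded (p ` {0..1})"
    using p by (intro compact_imp_bounded compact_continuous_image) auto
  then obtain M where "M > 0" and M: "\<And>u. u \<in> {0..1} \<Longrightarrow> \<bar>p u\<bar> \<le> M"
    unfolding bounded_pos by auto
  have "absolutely_continuous_curve a b (P \<circ> s)"
  proof (rule absolutely_continuous_curve_Lipschitz_compose[OF ac, of M])
    fix u v assume "u \<in> {a..b}" "v \<in> {a..b}"
    then show "norm ((P \<circ> s) u - (P \<circ> s) v) \<le> M * norm (s u - s v)"
      using field_differentiable_bound[of "{0..1}" P p M "s u" "s v"] P M s by auto
  qed (use \<open>M > 0\<close> in simp)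
  moreover have "((P \<circ> s) has_vector_derivative p (s t) * D t) (at t within {a..b})"
    if t: "t \<in> {a..b} - N" for t
  proof -
    have "(P has_real_derivative p (s t)) (at (s t) within s ` {a..b})"
      by (rule DERIV_subset[OF P]) (use s t in auto)
    from DERIV_image_chain[OF this D[OF t]] show ?thesis
      by (simp add: has_real_derivative_iff_has_vector_derivative)
  qed
  ultimately have "((\<lambda>t. p (s t) * D t) has_integral ((P \<circ> s) b - (P \<circ> s) a)) {a..b}"
    by (intro fundamental_theorem_of_calculus_absolutely_continuous[OF _ \<open>a \<le> b\<close> N])
  with \<open>s a = s b\<close> show ?thesis by simp
qed

theorem proposition4p2:
  fixes E :: "(real \<Rightarrow> real ^ 'n::finite) set"
    and H :: "(real \<Rightarrow> real ^ 'n) \<Rightarrow> real \<Rightarrow> real \<Rightarrow> real"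
    and c :: "real ^ 'n \<Rightarrow> real"
    and \<xi> :: "real \<Rightarrow> real ^ 'n"
    and a b :: real
    and x :: "real ^ 'n"
  assumes "network E"
    and "hamiltonians E H"
    and "flux_limiter E H c"
    and "a \<le> b"
    and "absolutely_continuous_curve a b \<xi>"
    and "x \<in> vertices E"
    and "\<xi> a = \<xi> b"
    and "\<exists>\<gamma>\<in>arcs_into E x. \<xi> ` {a..b} \<subseteq> \<gamma> ` {0..1}"
    and "\<xi> ` {a..b} \<inter> (vertices E - {x}) = {}"
  shows "extended_integral (lebesgue_on {a..b})
           (\<lambda>\<tau>. overall_lagrangian E H c (\<xi> \<tau>) (vector_derivative \<xi> (at \<tau> within {a..b})))
         \<ge> ereal (c x * (b - a))"
proof -
  interpret arc_network E by standard (rule assms(1))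
  obtain \<gamma> where \<gamma>: "\<gamma> \<in> arcs E" "\<gamma> 1 = x" and sub: "\<xi> ` {a..b} \<subseteq> \<gamma> ` {0..1}"
    using assms(8) by (auto simp: arcs_into_def)
  interpret convex_superlinear "H \<gamma>"
    by standard (use assms(2) \<gamma>(1) in \<open>auto simp: hamiltonians_def\<close>)
  have "finite (arcs_into E x)" using finite_arcs by (simp add: arcs_into_def)
  then have "(MIN \<gamma>\<in>arcs_into E x. arc_bound H \<gamma>) \<le> arc_bound H \<gamma>"
    using \<gamma> by (intro Min_le) (auto simp: arcs_into_def)
  then have c: "c x \<le> arc_bound H \<gamma>"
    using assms(3,6) unfolding flux_limiter_def by (meson order_trans)

  define s where "s t = inv_into {0..1} \<gamma> (\<xi> t)" for t
  have s: "s t \<in> {0..1}" "\<gamma> (s t) = \<xi> t" if "t \<in> {a..b}" for t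
    using sub that inv_into_into[of "\<xi> t" \<gamma> "{0..1}"] f_inv_into_f[of "\<xi> t" \<gamma> "{0..1}"]
    unfolding s_def by blast+
  obtain K where "K > 0" and K: "\<And>u v. u \<in> {0..1} \<Longrightarrow> v \<in> {0..1} \<Longrightarrow> \<bar>u - v\<bar> \<le> K * norm (\<gamma> u - \<gamma> v)"
    using arc_inverse_Lipschitz[OF \<gamma>(1)] by blast
  have ac: "absolutely_continuous_curve a b s"
  proof (rule absolutely_continuous_curve_Lipschitz_compose[OF assms(5), of K])
    fix u v assume "u \<in> {a..b}" "v \<in> {a..b}"
    then show "norm (s u - s v) \<le> K * norm (\<xi> u - \<xi> v)"
      using K[of "s u" "s v"] s by simp
  qed (use \<open>K > 0\<close> in simp)
  have cont: "continuous_on {a..b} s"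
    by (rule absolutely_continuous_curve_imp_continuous_on[OF ac])
  have "s a = s b" by (simp add: s_def assms(7))
  obtain N where N: "negligible N" "\<And>t. t \<in> {a..b} - N \<Longrightarrow> a < t \<and> t < b \<and> s differentiable at t"
    using absolutely_continuous_differentiable_ae[OF ac] by blast
  \<comment> \<open>The default 0 on the exceptional set lets the pointwise bound hold on all of
    \<open>[a, b]\<close>, including points of \<open>N\<close> with \<open>s t = 1\<close>.\<close>
  define D where "D t = (if t \<in> {a..b} - N then deriv s t else 0)" for t
  have D: "(s has_real_derivative D t) (at t)" if "t \<in> {a..b} - N" for t
    using N(2)[OF that] that by (simp add: D_def DERIV_deriv_iff_real_differentiable)
  have D0: "D t = 0" if t: "t \<in> {a..b}" "s t = 1" for t
  proof (cases "t \<in> N")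
    case False
    define d where "d = min (t - a) (b - t)"
    have "d > 0" using N(2)[of t] t False by (simp add: d_def)
    moreover have "s y \<le> s t" if "\<bar>t - y\<bar> < d" for y
    proof -
      have "y \<in> {a..b}" using that by (auto simp: d_def)
      then show ?thesis using s(1)[of y] t(2) by simp
    qed
    ultimately show ?thesis using DERIV_local_max[OF D, of t d] t False by blast
  qed (simp add: D_def)

  \<comment> \<open>A real-valued version of the Lagrangian along the curve. At
    \<open>s t = 1\<close> it is the flux limiter, which may be smaller than the Legendre transform
    at velocity 0.\<close>
  define f where "f t = (if s t < 1 then SUP \<mu>. D t * \<mu> - H \<gamma> (s t) \<mu> else c x)" for t
  \<comment> \<open>This serves only measurability: a gauge integrable function is Lebesgue
    measurable.\<close>
  have "(D has_integral (s b - s a)) {a..b}"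
    by (rule fundamental_theorem_of_calculus_absolutely_continuous[OF ac assms(4) N(1)])
      (use D in \<open>simp add: has_real_derivative_iff_has_vector_derivative[symmetric] has_field_derivative_at_within\<close>)
  then have "(\<lambda>t. indicator {a..b} t *\<^sub>R D t) \<in> borel_measurable lebesgue"
    by (rule has_integral_implies_lebesgue_measurable)
  then have Dm: "D \<in> borel_measurable (lebesgue_on {a..b})"
    by (simp add: borel_measurable_restrict_space_iff)
  have sm: "s \<in> borel_measurable (lebesgue_on {a..b})"
    using cont by (intro continuous_imp_measurable_on_sets_lebesgue) auto
  have fm: "f \<in> borel_measurable (lebesgue_on {a..b})"
    unfolding f_def using sm
    by (intro measurable_If borel_measurable_Legendre[OF cont s(1) Dm] borel_measurable_less) auto
  have F: "overall_lagrangian E H c (\<xi> t) (vector_derivative \<xi> (at t within {a..b})) = ereal (f t)"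
    if t: "t \<in> {a..b} - N" for t
  proof -
    have tab: "t \<in> {a..b}" "a < b" using t N(2)[OF t] by auto
    have "(s has_vector_derivative D t) (at t within {a..b})"
      using D[OF t] by (simp add: has_real_derivative_iff_has_vector_derivative has_vector_derivative_at_within)
    moreover have "(\<gamma> has_vector_derivative velocity \<gamma> (s t)) (at (s t) within s ` {a..b})"
      by (rule has_vector_derivative_within_subset[OF arc_has_vector_derivative[OF \<gamma>(1)]])
        (use s tab in auto)
    ultimately have "(\<gamma> \<circ> s has_vector_derivative D t *\<^sub>R velocity \<gamma> (s t)) (at t within {a..b})"
      by (rule vector_diff_chain_within)
    then have "(\<xi> has_vector_derivative D t *\<^sub>R velocity \<gamma> (s t)) (at t within {a..b})"
      by (rule has_vector_derivative_transform[OF tab(1), rotated]) (simp add: s)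
    then have v: "vector_derivative \<xi> (at t within {a..b}) = D t *\<^sub>R velocity \<gamma> (s t)"
      using vector_derivative_within_cbox[of a b t \<xi>] tab by simp
    show ?thesis
    proof (cases "s t < 1")
      case True
      \<comment> \<open>By injectivity \<open>x\<close> is met only at parameter 1, and the curve
        avoids every other vertex; hence the point is interior to the arc.\<close>
      have "\<gamma> (s t) \<noteq> x"
        using inj_onD[OF arc_inj_on[OF \<gamma>(1)], of "s t" 1] \<gamma>(2) s(1)[OF tab(1)] True by auto
      moreover have "\<xi> t \<notin> vertices E - {x}" using assms(9) tab(1) by blast
      ultimately have nv: "\<gamma> (s t) \<notin> vertices E" using s(2)[OF tab(1)] by simp
      have "s t \<noteq> 0"
      proof
        assume "s t = 0"
        then have "\<gamma> (s t) \<in> vertices E" using \<gamma>(1) by (auto simp: vertices_def)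
        with nv show False by simp
      qed
      then have "0 < s t" using s(1)[OF tab(1)] by simp
      from overall_lagrangian_arc[OF assms(2) \<gamma>(1) this True nv, of c "D t"] show ?thesis
        using True by (simp add: v s(2)[OF tab(1)] f_def arc_lagrangian_def)
    next
      case False
      then have "s t = 1" using s(1)[OF tab(1)] by simp
      then have "\<xi> t = \<gamma> 1" "D t = 0" using s(2)[OF tab(1)] D0[OF tab(1)] by auto
      with False show ?thesis
        using overall_lagrangian_vertex[OF \<gamma>(1), of H c] by (simp add: v f_def \<gamma>(2))
    qed
  qed
  obtain C where C: "\<And>s r. s \<in> {0..1} \<Longrightarrow> - C \<le> (SUP \<mu>. r * \<mu> - H \<gamma> s \<mu>)"
    using Legendre_lower_bound by blast
  have lower: "- max C (- c x) \<le> f t" if "t \<in> {a..b}" for t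
    using C[OF s(1)[OF that], of "D t"] unfolding f_def by auto

  show ?thesis
  proof (rule ereal_le_epsilon2)
    fix e :: real assume "e > 0"
    \<comment> \<open>The total loss is \<open>e' * (b - a)\<close>; the \<open>+ 1\<close> covers
      \<open>a = b\<close>.\<close>
    define e' where "e' = e / (b - a + 1)"
    have "e' > 0" and e': "e' * (b - a) \<le> e"
      using \<open>e > 0\<close> assms(4) by (auto simp: e'_def field_simps)
    obtain p where p: "continuous_on {0..1} p"
      "\<And>u. u \<in> {0..1} \<Longrightarrow> H \<gamma> u (p u) \<le> (SUP u\<in>{0..1}. INF \<mu>. H \<gamma> u \<mu>) + e'"
      using continuous_almost_minimizer[OF \<open>e' > 0\<close>] by blast
    have "((\<lambda>t. p (s t) * D t) has_integral 0) {a..b}"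
      by (rule absolutely_continuous_chain_rule_integral[OF ac assms(4) s(1) N(1) _ p(1) \<open>s a = s b\<close>])
        (use D in \<open>auto intro: has_field_derivative_at_within\<close>)
    from has_integral_add[OF this has_integral_const_real[of "c x - e'" a b]]
    have int: "((\<lambda>t. p (s t) * D t + (c x - e')) has_integral (c x - e') * (b - a)) {a..b}"
      using assms(4) by (simp add: mult.commute)
    have "ereal ((c x - e') * (b - a)) \<le> extended_integral (lebesgue_on {a..b})
           (\<lambda>\<tau>. overall_lagrangian E H c (\<xi> \<tau>) (vector_derivative \<xi> (at \<tau> within {a..b})))"
    proof (rule extended_integral_ge[OF fm N(1) F lower int])
      fix t assume t: "t \<in> {a..b}"
      show "p (s t) * D t + (c x - e') \<le> f t"
      proof (cases "s t < 1")
        case True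
        \<comment> \<open>Here the flux limiter condition enters:
          \<open>c x \<le> arc_bound H \<gamma>\<close> turns this bound on the Hamiltonian into one
          by \<open>e' - c x\<close>.\<close>
        have "H \<gamma> (s t) (p (s t)) \<le> - arc_bound H \<gamma> + e'"
          using p(2)[OF s(1)[OF t]] by (simp add: arc_bound_def)
        moreover have "D t * p (s t) - H \<gamma> (s t) (p (s t)) \<le> f t"
          using Legendre_ge[OF s(1)[OF t], of "D t" "p (s t)"] True by (simp add: f_def)
        ultimately show ?thesis using c by (simp add: mult.commute)
      next
        case False
        then have "D t = 0" using s(1)[OF t] by (intro D0[OF t]) simp
        with False \<open>e' > 0\<close> show ?thesis by (simp add: f_def)
      qed
    qed
    then have "ereal ((c x - e') * (b - a)) + ereal e \<le> extended_integral (lebesgue_on {a..b})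
           (\<lambda>\<tau>. overall_lagrangian E H c (\<xi> \<tau>) (vector_derivative \<xi> (at \<tau> within {a..b}))) + ereal e"
      by (rule add_right_mono)
    moreover have "ereal (c x * (b - a)) \<le> ereal ((c x - e') * (b - a)) + ereal e"
      using e' by (simp add: algebra_simps)
    ultimately show "ereal (c x * (b - a)) \<le> extended_integral (lebesgue_on {a..b})
           (\<lambda>\<tau>. overall_lagrangian E H c (\<xi> \<tau>) (vector_derivative \<xi> (at \<tau> within {a..b}))) + ereal e"
      by (rule order_trans[rotated])
  qed
qed

end
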